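(* Let $f:\mathbb P^n\dashrightarrow\mathbb P^n$, $x\mapsto[f_0(x):\cdots:f_n(x)]$, be a (complex) Cremona transformation of bidegree $(2,2)$, where $f_0,\dots,f_n$ are quadratic forms without common factor, and let $N(x)=0$ be a cubic equation cutting out the secant scheme of the base locus scheme of $f$. Then the rational map $$\mathbb P^{n+1}\dashrightarrow\mathbb P^{n+1},\qquad [x:r]\longmapsto\big[r f_0(x):\cdots:r f_n(x):N(x)\big]$$ is a Cremona transformation of bidegree $(3,3)$ of Spampinato type.
   Context: Everything is over $\mathbb C$. A Cremona transformation of $\mathbb P^n$ has bidegree $(d_1,d_2)$ if it is given by forms of degree $d_1$ without common factor and its inverse by forms of degree $d_2$ without common factor. Two Cremona transformations $f,\tilde f$ of $\mathbb P^n$ are linearly equivalent if $\tilde f=\ell_1\circ f\circ\ell_2$ with $\ell_1,\ell_2\in\mathrm{Aut}(\mathbb P^n)$. Cubic $N$: if $F=(f_0,\dots,f_n)$ and $G=(g_0,\dots,g_n)$ are quadratic lifts to $\mathbb C^{n+1}$ (without common factor) of $f$ and $f^{-1}$, then there is a cubic form $N$ with $G(F(x))=N(x)x$ for all $x$. The hypersurface $V(N)\subset\mathbb P^n$ is the secant scheme of the base locus scheme of $f$; $N$ is determined up to a nonzero scalar. Spampinato type: for a finite-dimensional commutative unital power-associative complex algebra $A$ of rank $\rho$ (the dimension of the subalgebra generated by the unity $e$ and a general element), with generic minimal equation $x^{\rho}-\sigma_1(x)x^{\rho-1}+\cdots+(-1)^{\rho}\sigma_{\rho}(x)e=0$, the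 adjoint is $x^\#=(-1)^{\rho-1}\big(x^{\rho-1}-\sigma_1(x)x^{\rho-2}+\cdots+(-1)^{\rho-1}\sigma_{\rho-1}(x)e\big)$, and its projectivization is a birational involution of $\mathbb P(A)$. A Cremona transformation of bidegree $(3,3)$ is of Spampinato type if it is linearly equivalent to the projectivization of the adjoint of a direct product algebra $J\times\mathbb C$ with $J$ power-associative of rank $3$ (this adjoint is $(x,s)\mapsto(s\,x^\#,N_J(x))$, where $N_J=\sigma_3$ is the generic norm of $J$). *)

theory Defs
  imports "HOL-Analysis.Analysis"
begin

section \<open>Polynomials, forms and common factors\<close>

text \<open>The coordinates of the projective space of dimension n are indexed by a finite type
  with n + 1 elements.  Since the complex field is infinite, polynomials are identified with
  the polynomial functions they define.\<close>

definition monom_fun :: "('n::finite \<Rightarrow> nat) \<Rightarrow> complex^'n \<Rightarrow> complex" where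
  "monom_fun m x = (\<Prod>i\<in>UNIV. x $ i ^ m i)"

definition is_polynomial :: "(complex^'n::finite \<Rightarrow> complex) \<Rightarrow> bool" where
  "is_polynomial p \<longleftrightarrow>
     (\<exists>M c. finite M \<and> p = (\<lambda>x. \<Sum>m\<in>M. c m * monom_fun m x))"

text \<open>The zero polynomial is a form of every degree.\<close>

definition is_form :: "nat \<Rightarrow> (complex^'n::finite \<Rightarrow> complex) \<Rightarrow> bool" where
  "is_form d p \<longleftrightarrow>
     (\<exists>M c. finite M \<and> (\<forall>m\<in>M. (\<Sum>i\<in>UNIV. m i) = d) \<and>
        p = (\<lambda>x. \<Sum>m\<in>M. c m * monom_fun m x))"

definition form_tuple :: "nat \<Rightarrow> (complex^'n::finite \<Rightarrow> complex^'m::finite) \<Rightarrow> bool" where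
  "form_tuple d F \<longleftrightarrow> (\<forall>i. is_form d (\<lambda>x. F x $ i))"

definition no_common_factor :: "(complex^'n::finite \<Rightarrow> complex^'m::finite) \<Rightarrow> bool" where
  "no_common_factor F \<longleftrightarrow>
     (\<forall>h. is_polynomial h \<and>
          (\<forall>i. \<exists>q. is_polynomial q \<and> (\<forall>x. F x $ i = h x * q x))
        \<longrightarrow> (\<exists>c. \<forall>x. h x = c))"


section \<open>Rational self-maps of projective space\<close>

text \<open>A rational map is given by a tuple of forms of one degree, not all zero.  Two
  tuples give the same rational map iff they are proportional over the field of rational
  functions, that is, iff their 2 by 2 minors vanish identically.\<close>

definition ratmap :: "(complex^'n::finite \<Rightarrow> complex^'n) \<Rightarrow> bool" where
  "ratmap F \<longleftrightarrow> (\<exists>d. form_tuple d F) \<and> (\<exists>x. F x \<noteq> 0)"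

definition ratmap_eq ::
  "(complex^'n::finite \<Rightarrow> complex^'n) \<Rightarrow> (complex^'n \<Rightarrow> complex^'n) \<Rightarrow> bool" where
  "ratmap_eq F G \<longleftrightarrow> ratmap F \<and> ratmap G \<and>
     (\<forall>x i j. F x $ i * G x $ j = F x $ j * G x $ i)"

text \<open>Via \<open>ratmap\<close>, this includes that both composites are defined, i.e. not
  identically zero.\<close>

definition birational_inverse ::
  "(complex^'n::finite \<Rightarrow> complex^'n) \<Rightarrow> (complex^'n \<Rightarrow> complex^'n) \<Rightarrow> bool" where
  "birational_inverse F G \<longleftrightarrow> ratmap F \<and> ratmap G \<and>
     ratmap_eq (G \<circ> F) (\<lambda>x. x) \<and> ratmap_eq (F \<circ> G) (\<lambda>x. x)"

text \<open>A property of the rational map given by \<open>H\<close>: the tuple \<open>H\<close> itself is allowed to have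
  a common factor.\<close>

definition cremona_bidegree ::
  "nat \<Rightarrow> nat \<Rightarrow> (complex^'n::finite \<Rightarrow> complex^'n) \<Rightarrow> bool" where
  "cremona_bidegree d1 d2 H \<longleftrightarrow>
     (\<exists>F G. form_tuple d1 F \<and> no_common_factor F \<and> ratmap_eq H F \<and>
            form_tuple d2 G \<and> no_common_factor G \<and> birational_inverse F G)"

definition linearly_equivalent ::
  "(complex^'n::finite \<Rightarrow> complex^'n) \<Rightarrow> (complex^'n \<Rightarrow> complex^'n) \<Rightarrow> bool" where
  "linearly_equivalent F F' \<longleftrightarrow>
     (\<exists>(A :: complex^'n^'n) (B :: complex^'n^'n). invertible A \<and> invertible B \<and>
        ratmap_eq F' (\<lambda>x. A *v F (B *v x)))"

text \<open>For a quadratic lift \<open>F\<close> without common factor of a Cremona transformation of bidegree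
  (2,2), the secant scheme of its base locus scheme is the hypersurface V(N), where
  G(F(x)) = N(x) x for a quadratic lift \<open>G\<close> without common factor of the inverse.  As \<open>G\<close> is
  unique up to a nonzero scalar, so is \<open>N\<close>.\<close>

definition secant_cubic ::
  "(complex^'n::finite \<Rightarrow> complex^'n) \<Rightarrow> (complex^'n \<Rightarrow> complex) \<Rightarrow> bool" where
  "secant_cubic F N \<longleftrightarrow> is_form 3 N \<and>
     (\<exists>G. form_tuple 2 G \<and> no_common_factor G \<and> birational_inverse F G \<and>
          (\<forall>x. G (F x) = N x *s x))"


section \<open>Commutative unital power-associative algebras\<close>

text \<open>A finite-dimensional complex algebra is given, in coordinates with respect to a basis, by
  a product \<open>m\<close> with unity \<open>e\<close> on a coordinate space.\<close>

definition comm_unital_algebra ::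
  "(complex^'n::finite \<Rightarrow> complex^'n \<Rightarrow> complex^'n) \<Rightarrow> complex^'n \<Rightarrow> bool" where
  "comm_unital_algebra m e \<longleftrightarrow>
     (\<forall>x. Vector_Spaces.linear (*s) (*s) (m x)) \<and>
     (\<forall>x y. m x y = m y x) \<and> (\<forall>x. m e x = x)"

definition unital_subalgebra ::
  "(complex^'n::finite \<Rightarrow> complex^'n \<Rightarrow> complex^'n) \<Rightarrow> complex^'n \<Rightarrow> (complex^'n) set \<Rightarrow> bool" where
  "unital_subalgebra m e S \<longleftrightarrow>
     vec.subspace S \<and> e \<in> S \<and> (\<forall>x\<in>S. \<forall>y\<in>S. m x y \<in> S)"

definition generated_subalgebra ::
  "(complex^'n::finite \<Rightarrow> complex^'n \<Rightarrow> complex^'n) \<Rightarrow> complex^'n \<Rightarrow> complex^'n \<Rightarrow> (complex^'n) set" where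
  "generated_subalgebra m e x = unital_subalgebra m e hull {x}"

definition power_associative ::
  "(complex^'n::finite \<Rightarrow> complex^'n \<Rightarrow> complex^'n) \<Rightarrow> complex^'n \<Rightarrow> bool" where
  "power_associative m e \<longleftrightarrow>
     (\<forall>x. \<forall>a\<in>generated_subalgebra m e x. \<forall>b\<in>generated_subalgebra m e x.
        \<forall>c\<in>generated_subalgebra m e x. m (m a b) c = m a (m b c))"

definition power_associative_algebra ::
  "(complex^'n::finite \<Rightarrow> complex^'n \<Rightarrow> complex^'n) \<Rightarrow> complex^'n \<Rightarrow> bool" where
  "power_associative_algebra m e \<longleftrightarrow> comm_unital_algebra m e \<and> power_associative m e"

text \<open>``General'' means: outside the zero set of some nonzero polynomial \<open>p\<close>.\<close>

definition algebra_rank ::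
  "(complex^'n::finite \<Rightarrow> complex^'n \<Rightarrow> complex^'n) \<Rightarrow> complex^'n \<Rightarrow> nat \<Rightarrow> bool" where
  "algebra_rank m e \<rho> \<longleftrightarrow>
     (\<exists>p. is_polynomial p \<and> (\<exists>x. p x \<noteq> 0) \<and>
          (\<forall>x. p x \<noteq> 0 \<longrightarrow> vec.dim (generated_subalgebra m e x) = \<rho>))"

primrec algebra_power ::
  "(complex^'n::finite \<Rightarrow> complex^'n \<Rightarrow> complex^'n) \<Rightarrow> complex^'n \<Rightarrow> complex^'n \<Rightarrow> nat \<Rightarrow> complex^'n" where
  "algebra_power m e x 0 = e"
| "algebra_power m e x (Suc k) = m x (algebra_power m e x k)"

text \<open>\<open>\<sigma> i\<close> is the i-th coefficient of the generic minimal equation, with \<open>\<sigma> 0 = 1\<close>; if \<open>\<rho>\<close> is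
  the rank, then \<open>\<sigma> 0, \<dots>, \<sigma> \<rho>\<close> are uniquely determined.\<close>

definition generic_minimal_equation ::
  "(complex^'n::finite \<Rightarrow> complex^'n \<Rightarrow> complex^'n) \<Rightarrow> complex^'n \<Rightarrow> nat \<Rightarrow>
     (nat \<Rightarrow> complex^'n \<Rightarrow> complex) \<Rightarrow> bool" where
  "generic_minimal_equation m e \<rho> \<sigma> \<longleftrightarrow>
     algebra_rank m e \<rho> \<and> (\<forall>x. \<sigma> 0 x = 1) \<and> (\<forall>i\<le>\<rho>. is_form i (\<sigma> i)) \<and>
     (\<forall>x. (\<Sum>i\<le>\<rho>. ((-1) ^ i * \<sigma> i x) *s algebra_power m e x (\<rho> - i)) = 0)"

definition algebra_adjoint ::
  "(complex^'n::finite \<Rightarrow> complex^'n \<Rightarrow> complex^'n) \<Rightarrow> complex^'n \<Rightarrow> nat \<Rightarrow>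
     (nat \<Rightarrow> complex^'n \<Rightarrow> complex) \<Rightarrow> complex^'n \<Rightarrow> complex^'n" where
  "algebra_adjoint m e \<rho> \<sigma> x =
     (-1) ^ (\<rho> - 1) *s
       (\<Sum>i<\<rho>. ((-1) ^ i * \<sigma> i x) *s algebra_power m e x (\<rho> - 1 - i))"


section \<open>Direct product with the complex numbers, and Spampinato type\<close>

text \<open>The extra coordinate, indexed by \<open>None\<close>, is the last one.\<close>

definition append_coord :: "complex^'n::finite \<Rightarrow> complex \<Rightarrow> complex^('n option)" where
  "append_coord x r = (\<chi> i. case i of Some j \<Rightarrow> x $ j | None \<Rightarrow> r)"

definition drop_coord :: "complex^('n::finite option) \<Rightarrow> complex^'n" where
  "drop_coord u = (\<chi> j. u $ Some j)"

definition last_coord :: "complex^('n::finite option) \<Rightarrow> complex" where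
  "last_coord u = u $ None"

definition times_C_mult ::
  "(complex^'n::finite \<Rightarrow> complex^'n \<Rightarrow> complex^'n) \<Rightarrow>
     complex^('n option) \<Rightarrow> complex^('n option) \<Rightarrow> complex^('n option)" where
  "times_C_mult m u v =
     append_coord (m (drop_coord u) (drop_coord v)) (last_coord u * last_coord v)"

definition times_C_unit :: "complex^'n::finite \<Rightarrow> complex^('n option)" where
  "times_C_unit e = append_coord e 1"

text \<open>To be used for Cremona transformations of bidegree (3,3).\<close>

definition spampinato_type ::
  "(complex^('n::finite option) \<Rightarrow> complex^('n option)) \<Rightarrow> bool" where
  "spampinato_type H \<longleftrightarrow>
     (\<exists>(m :: complex^'n \<Rightarrow> complex^'n \<Rightarrow> complex^'n) e \<rho> \<sigma>.
        power_associative_algebra m e \<and> algebra_rank m e 3 \<and>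
        generic_minimal_equation (times_C_mult m) (times_C_unit e) \<rho> \<sigma> \<and>
        linearly_equivalent
          (algebra_adjoint (times_C_mult m) (times_C_unit e) \<rho> \<sigma>) H)"

end

theory Submission imports Defs
begin

text \<open>Let \<open>G\<close> be a quadratic lift of the inverse, \<open>G (F x) = N x x\<close> and \<open>F (G y) = M y y\<close>, and choose
  \<open>e\<close> with \<open>N e = 1\<close>.  Let \<open>\<tau>\<close> be the derivative of \<open>N\<close> at \<open>e\<close> and write \<open>F(e, v)\<close> for the polarization.
  The linear map \<open>\<phi> v = \<tau> v F e - F(e, v)\<close> is invertible, and \<open>Q = \<phi>\<inverse> F\<close>, \<open>R = G \<phi>\<close> satisfy
  \<open>R (Q x) = N x x\<close>, \<open>Q e = R e = e\<close> and \<open>Q(e, v) = R(e, v) = \<tau> v e - v\<close>.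

  The key point is \<open>Q = R\<close>.  Expanding \<open>Q \<circ> R\<close> at \<open>e\<close> shows that \<open>Q w - R w\<close> is a multiple \<open>\<epsilon> e\<close> of \<open>e\<close>;
  then \<open>Q (R w)\<close> and \<open>R (Q w)\<close> being multiples of \<open>w\<close> puts \<open>\<epsilon> Q w\<close> into the span of \<open>e\<close> and \<open>w\<close>.
  If \<open>Q w\<close> itself always lay in that span, then the components of \<open>F\<close> would have a common linear factor.
  Hence generically \<open>\<epsilon> = 0\<close>, and so \<open>Q = R\<close> everywhere.

  Now \<open>Q (Q x) = N x x\<close>, and linearizing this at \<open>e\<close> shows that the product with square
  \<open>x\<^sup>2 = Q x + \<tau> x x - \<tau> (Q x) e\<close> satisfies \<open>x Q x = N x e\<close> and \<open>x\<^sup>2 x\<^sup>2 = x x\<^sup>3\<close>.  It is therefore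
  power-associative of rank 3 with adjoint \<open>Q\<close>, which is \<open>F\<close> up to the linear map \<open>\<phi>\<close>.\<close>

section \<open>Polynomials and forms\<close>

text \<open>Forms of degree \<open>d\<close> are the case \<open>D = {d}\<close> and polynomials the
  case \<open>D = UNIV\<close>, so the closure properties are proved once for both.\<close>

definition poly_of_degrees :: "nat set \<Rightarrow> (complex^'n::finite \<Rightarrow> complex) \<Rightarrow> bool" where
  "poly_of_degrees D p \<longleftrightarrow>
     (\<exists>M c. finite M \<and> (\<forall>m\<in>M. (\<Sum>i\<in>UNIV. m i) \<in> D) \<and>
        p = (\<lambda>x. \<Sum>m\<in>M. c m * monom_fun m x))"

lemma is_form_iff: "is_form d p \<longleftrightarrow> poly_of_degrees {d} p"
  by (simp add: is_form_def poly_of_degrees_def)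

lemma is_polynomial_iff: "is_polynomial p \<longleftrightarrow> poly_of_degrees UNIV p"
  by (simp add: is_polynomial_def poly_of_degrees_def)

lemma poly_of_degrees_mono: "poly_of_degrees D p \<Longrightarrow> D \<subseteq> E \<Longrightarrow> poly_of_degrees E p"
  unfolding poly_of_degrees_def by blast

lemma is_form_imp_polynomial: "is_form d p \<Longrightarrow> is_polynomial p"
  unfolding is_form_iff is_polynomial_iff by (rule poly_of_degrees_mono) auto

lemma poly_of_degrees_zero: "poly_of_degrees D (\<lambda>x. 0)"
  unfolding poly_of_degrees_def by (rule exI[of _ "{}"]) auto

lemma poly_of_degrees_monom:
  "(\<Sum>i\<in>UNIV. m i) \<in> D \<Longrightarrow> poly_of_degrees D (\<lambda>x. c * monom_fun m x)"
  unfolding poly_of_degrees_def by (rule exI[of _ "{m}"], rule exI[of _ "\<lambda>_. c"]) auto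

lemma poly_of_degrees_add:
  assumes "poly_of_degrees D p" "poly_of_degrees D q"
  shows "poly_of_degrees D (\<lambda>x. p x + q x)"
proof -
  obtain M c where M: "finite M" "\<forall>m\<in>M. (\<Sum>i\<in>UNIV. m i) \<in> D"
    "p = (\<lambda>x. \<Sum>m\<in>M. c m * monom_fun m x)"
    using assms(1) unfolding poly_of_degrees_def by blast
  obtain M' c' where M': "finite M'" "\<forall>m\<in>M'. (\<Sum>i\<in>UNIV. m i) \<in> D"
    "q = (\<lambda>x. \<Sum>m\<in>M'. c' m * monom_fun m x)"
    using assms(2) unfolding poly_of_degrees_def by blast
  \<comment> \<open>The coefficient functions are arbitrary outside \<open>M\<close> and
    \<open>M'\<close>, so each is cut off to zero there before they are added over the
    union.\<close>
  define d where "d = (\<lambda>m. (if m \<in> M then c m else 0) + (if m \<in> M' then c' m else 0))"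
  have "p x + q x = (\<Sum>m\<in>M \<union> M'. d m * monom_fun m x)" for x
  proof -
    have "p x = (\<Sum>m\<in>M \<union> M'. (if m \<in> M then c m else 0) * monom_fun m x)"
      unfolding M(3) using M(1) M'(1) by (intro sum.mono_neutral_cong_left) auto
    moreover have "q x = (\<Sum>m\<in>M \<union> M'. (if m \<in> M' then c' m else 0) * monom_fun m x)"
      unfolding M'(3) using M(1) M'(1) by (intro sum.mono_neutral_cong_left) auto
    ultimately show ?thesis
      unfolding d_def distrib_right sum.distrib by simp
  qed
  then show ?thesis
    unfolding poly_of_degrees_def
    by (intro exI[of _ "M \<union> M'"] exI[of _ d]) (use M M' in auto)
qed

lemma poly_of_degrees_sum:
  "(\<And>i. i \<in> I \<Longrightarrow> poly_of_degrees D (p i)) \<Longrightarrow> poly_of_degrees D (\<lambda>x. \<Sum>i\<in>I. p i x)"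
  by (induction I rule: infinite_finite_induct)
     (auto intro: poly_of_degrees_zero poly_of_degrees_add)

lemma monom_fun_mult: "monom_fun m x * monom_fun m' x = monom_fun (\<lambda>i. m i + m' i) x"
  by (simp add: monom_fun_def power_add prod.distrib)

lemma poly_of_degrees_mult:
  assumes "poly_of_degrees D p" "poly_of_degrees E q" "\<And>a b. a \<in> D \<Longrightarrow> b \<in> E \<Longrightarrow> a + b \<in> K"
  shows "poly_of_degrees K (\<lambda>x. p x * q x)"
proof -
  obtain M c where M: "\<forall>m\<in>M. (\<Sum>i\<in>UNIV. m i) \<in> D"
    "p = (\<lambda>x. \<Sum>m\<in>M. c m * monom_fun m x)"
    using assms(1) unfolding poly_of_degrees_def by blast
  obtain M' c' where M': "\<forall>m\<in>M'. (\<Sum>i\<in>UNIV. m i) \<in> E"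
    "q = (\<lambda>x. \<Sum>m\<in>M'. c' m * monom_fun m x)"
    using assms(2) unfolding poly_of_degrees_def by blast
  have "(\<lambda>x. p x * q x) =
    (\<lambda>x. \<Sum>m\<in>M. \<Sum>m'\<in>M'. (c m * c' m') * monom_fun (\<lambda>i. m i + m' i) x)"
    unfolding M M' sum_product
    by (simp add: monom_fun_mult[symmetric] mult_ac)
  moreover have "poly_of_degrees K
    (\<lambda>x. \<Sum>m\<in>M. \<Sum>m'\<in>M'. (c m * c' m') * monom_fun (\<lambda>i. m i + m' i) x)"
    by (intro poly_of_degrees_sum poly_of_degrees_monom)
       (use M M' assms(3) in \<open>auto simp: sum.distrib\<close>)
  ultimately show ?thesis by simp
qed

lemma poly_of_degrees_const: "0 \<in> D \<Longrightarrow> poly_of_degrees D (\<lambda>x. c)"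
  using poly_of_degrees_monom[of "\<lambda>_. 0" D c] by (simp add: monom_fun_def)

lemma poly_of_degrees_coord:
  assumes "1 \<in> D"
  shows "poly_of_degrees D (\<lambda>x. x $ i)"
proof -
  have "monom_fun (\<lambda>j. if j = i then 1 else 0) x = x $ i" for x
    unfolding monom_fun_def by (simp add: if_distrib[of "\<lambda>k. _ ^ k"] cong: if_cong)
  then show ?thesis
    using poly_of_degrees_monom[of "\<lambda>j. if j = i then 1 else 0" D 1] assms by simp
qed

lemmas is_form_add = poly_of_degrees_add[of "{d}" for d, folded is_form_iff]
lemmas is_form_sum = poly_of_degrees_sum[of _ "{d}" for d, folded is_form_iff]

lemma is_form_mult: "is_form a p \<Longrightarrow> is_form b q \<Longrightarrow> is_form (a + b) (\<lambda>x. p x * q x)"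
  unfolding is_form_iff by (erule poly_of_degrees_mult) auto

lemma is_form_const: "is_form 0 (\<lambda>x. c)"
  unfolding is_form_iff by (rule poly_of_degrees_const) simp

lemma is_form_coord: "is_form 1 (\<lambda>x. x $ i)"
  unfolding is_form_iff by (rule poly_of_degrees_coord) simp

lemma is_form_scale: "is_form d p \<Longrightarrow> is_form d (\<lambda>x. c * p x)"
  using is_form_mult[OF is_form_const] by fastforce

lemmas is_polynomial_add = poly_of_degrees_add[of UNIV, folded is_polynomial_iff]
lemmas is_polynomial_sum = poly_of_degrees_sum[of _ UNIV, folded is_polynomial_iff]

lemma is_polynomial_mult:
  "is_polynomial p \<Longrightarrow> is_polynomial q \<Longrightarrow> is_polynomial (\<lambda>x. p x * q x)"
  unfolding is_polynomial_iff by (erule poly_of_degrees_mult) auto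

lemma is_polynomial_const: "is_polynomial (\<lambda>x. c)"
  unfolding is_polynomial_iff by (rule poly_of_degrees_const) simp

lemma is_polynomial_coord: "is_polynomial (\<lambda>x. x $ i)"
  unfolding is_polynomial_iff by (rule poly_of_degrees_coord) simp

lemma is_polynomial_minus:
  "is_polynomial p \<Longrightarrow> is_polynomial q \<Longrightarrow> is_polynomial (\<lambda>x. p x - q x)"
  using is_polynomial_add[OF _ is_polynomial_mult[OF is_polynomial_const, of q "-1"]] by fastforce

lemma is_polynomial_power: "is_polynomial p \<Longrightarrow> is_polynomial (\<lambda>x. p x ^ k)"
  by (induction k) (auto intro: is_polynomial_const is_polynomial_mult)

lemma is_polynomial_prod:
  "(\<And>i. i \<in> I \<Longrightarrow> is_polynomial (p i)) \<Longrightarrow> is_polynomial (\<lambda>x. \<Prod>i\<in>I. p i x)"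
  by (induction I rule: infinite_finite_induct)
     (auto intro: is_polynomial_const is_polynomial_mult)

lemma is_polynomial_compose:
  assumes "is_polynomial p" "\<And>i. is_polynomial (\<lambda>x. L x $ i)"
  shows "is_polynomial (\<lambda>x. p (L x))"
proof -
  obtain M c where p: "p = (\<lambda>x. \<Sum>m\<in>M. c m * monom_fun m x)"
    using assms(1) unfolding is_polynomial_def by blast
  show ?thesis
    unfolding p monom_fun_def
    by (intro is_polynomial_sum is_polynomial_mult is_polynomial_const is_polynomial_prod
        is_polynomial_power assms(2))
qed

section \<open>Splitting variables off monomials and forms\<close>

lemma monom_fun_lower:
  assumes "m k > 0"
  shows "monom_fun m x = x $ k * monom_fun (m(k := m k - 1)) x"
proof -
  have "monom_fun m x = x $ k ^ m k * (\<Prod>i\<in>UNIV - {k}. x $ i ^ m i)"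
    unfolding monom_fun_def by (simp add: prod.remove)
  moreover have "monom_fun (m(k := m k - 1)) x
      = x $ k ^ (m k - 1) * (\<Prod>i\<in>UNIV - {k}. x $ i ^ m i)"
    unfolding monom_fun_def by (simp add: prod.remove[of _ k])
  moreover have "x $ k ^ m k = x $ k * x $ k ^ (m k - 1)"
    using assms by (metis power_minus_mult mult.commute)
  ultimately show ?thesis by simp
qed

lemma sum_exponent_lower:
  fixes m :: "'n::finite \<Rightarrow> nat"
  assumes "m k > 0"
  shows "(\<Sum>i\<in>UNIV. m i) = Suc (\<Sum>i\<in>UNIV. (m(k := m k - 1)) i)"
  using assms by (simp add: sum.remove[of UNIV k])

text \<open>Every monomial of positive degree contains some variable; one is chosen and split off,
  and the monomials are grouped by that choice. This drives inductions on the degree.\<close>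

lemma is_form_Suc_decompose:
  assumes "is_form (Suc d) (p :: complex^'n::finite \<Rightarrow> complex)"
  obtains q where "\<And>i. is_form d (q i)" "\<And>x. p x = (\<Sum>i\<in>UNIV. x $ i * q i x)"
proof -
  obtain M c where M: "finite M" "\<forall>m\<in>M. (\<Sum>i\<in>UNIV. m i) = Suc d"
    "p = (\<lambda>x. \<Sum>m\<in>M. c m * monom_fun m x)"
    using assms unfolding is_form_def by blast
  have "\<forall>m\<in>M. \<exists>i. m i > 0"
  proof
    fix m assume "m \<in> M"
    then have "(\<Sum>i\<in>UNIV. m i) \<noteq> 0" using M(2) by simp
    then show "\<exists>i. m i > 0" by (meson sum.neutral neq0_conv)
  qed
  then obtain k where k: "\<And>m. m \<in> M \<Longrightarrow> m (k m) > 0" by metis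
  define m' where "m' = (\<lambda>m :: 'n \<Rightarrow> nat. m(k m := m (k m) - 1))"
  have split: "monom_fun m x = x $ k m * monom_fun (m' m) x" and
    deg: "(\<Sum>i\<in>UNIV. m' m i) = d" if "m \<in> M" for m x
    using monom_fun_lower[of m, OF k[OF that]] sum_exponent_lower[of m, OF k[OF that]] M(2) that
    unfolding m'_def by auto
  define q where "q = (\<lambda>i x. \<Sum>m | m \<in> M \<and> k m = i. c m * monom_fun (m' m) x)"
  show thesis
  proof
    show "is_form d (q i)" for i
      unfolding q_def is_form_iff
      by (intro poly_of_degrees_sum poly_of_degrees_monom) (use deg in auto)
    show "p x = (\<Sum>i\<in>UNIV. x $ i * q i x)" for x
    proof -
      have "p x = (\<Sum>m\<in>M. x $ k m * (c m * monom_fun (m' m) x))"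
        unfolding M(3) by (intro sum.cong) (use split in auto)
      also have "\<dots> = (\<Sum>i\<in>UNIV. \<Sum>m | m \<in> M \<and> k m = i. x $ k m * (c m * monom_fun (m' m) x))"
        using sum.group[OF M(1) finite[of UNIV], of k "\<lambda>m. x $ k m * (c m * monom_fun (m' m) x)"]
        by simp
      also have "\<dots> = (\<Sum>i\<in>UNIV. x $ i * q i x)"
        unfolding q_def sum_distrib_left by (intro sum.cong) auto
      finally show ?thesis .
    qed
  qed
qed

lemma is_form_0_const: "is_form 0 p \<Longrightarrow> p x = p y"
  unfolding is_form_def monom_fun_def by (auto intro!: sum.cong)

lemma is_form_homogeneous: "is_form d p \<Longrightarrow> p (c *s x) = c ^ d * p x"
proof (induction d arbitrary: p)
  case 0
  then show ?case using is_form_0_const by simp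
next
  case (Suc d)
  from Suc.prems obtain q where q: "\<And>i. is_form d (q i)" "\<And>x. p x = (\<Sum>i\<in>UNIV. x $ i * q i x)"
    by (rule is_form_Suc_decompose) blast
  show ?case
    unfolding q(2) sum_distrib_left by (intro sum.cong) (simp_all add: Suc.IH[OF q(1)])
qed

lemma is_form_compose:
  assumes "is_form d p" "form_tuple k L"
  shows "is_form (d * k) (\<lambda>x. p (L x))"
  using assms(1)
proof (induction d arbitrary: p)
  case 0
  then have "(\<lambda>x. p (L x)) = (\<lambda>x. p 0)" using is_form_0_const by blast
  then show ?case using is_form_const by simp
next
  case (Suc d)
  from Suc.prems obtain q where q: "\<And>i. is_form d (q i)" "\<And>x. p x = (\<Sum>i\<in>UNIV. x $ i * q i x)"
    by (rule is_form_Suc_decompose) blast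
  show ?case
    unfolding q(2) mult_Suc
    by (intro is_form_sum is_form_mult Suc.IH q(1)) (use assms(2) in \<open>auto simp: form_tuple_def\<close>)
qed

text \<open>Setting the \<open>j\<close>-th variable to zero kills the monomials that contain it and
  fixes the others. Hence the others sum to zero, and each remaining monomial is divisible by that
  variable.\<close>

lemma is_form_dvd_coord:
  assumes "is_form (Suc d) p" "\<And>x. x $ j = 0 \<Longrightarrow> p x = 0"
  obtains q where "is_form d q" "\<And>x. p x = x $ j * q x"
proof -
  obtain M c where M: "finite M" "\<forall>m\<in>M. (\<Sum>i\<in>UNIV. m i) = Suc d"
    "p = (\<lambda>x. \<Sum>m\<in>M. c m * monom_fun m x)"
    using assms(1) unfolding is_form_def by blast
  define A B where "A = {m \<in> M. m j > 0}" and "B = {m \<in> M. m j = 0}"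
  have "M = A \<union> B" "A \<inter> B = {}" "finite A" "finite B" using M(1) by (auto simp: A_def B_def)
  then have p: "p x = (\<Sum>m\<in>A. c m * monom_fun m x) + (\<Sum>m\<in>B. c m * monom_fun m x)" for x
    unfolding M(3) by (simp add: sum.union_disjoint)
  define z where "z = (\<lambda>x :: complex^_. \<chi> i. if i = j then 0 else x $ i)"
  have "monom_fun m (z x) = 0" if "m \<in> A" for m x
    using that unfolding monom_fun_def A_def z_def by (auto intro!: prod_zero)
  moreover have "monom_fun m (z x) = monom_fun m x" if "m \<in> B" for m x
    using that unfolding monom_fun_def B_def z_def by (auto intro!: prod.cong)
  ultimately have "p (z x) = (\<Sum>m\<in>B. c m * monom_fun m x)" for x
    unfolding p by simp
  then have B0: "(\<Sum>m\<in>B. c m * monom_fun m x) = 0" for x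
    using assms(2)[of "z x"] by (simp add: z_def)
  define q where "q = (\<lambda>x. \<Sum>m\<in>A. c m * monom_fun (m(j := m j - 1)) x)"
  show thesis
  proof
    have "(\<Sum>i\<in>UNIV. (m(j := m j - 1)) i) = d" if "m \<in> A" for m
      using sum_exponent_lower[of m j] that M(2) unfolding A_def by auto
    then show "is_form d q"
      unfolding q_def is_form_iff by (intro poly_of_degrees_sum poly_of_degrees_monom) simp
    show "p x = x $ j * q x" for x
      unfolding p B0 q_def sum_distrib_left using monom_fun_lower[of _ j]
      by (auto simp: A_def intro!: sum.cong)
  qed
qed

section \<open>Restriction to lines and the identity principle\<close>

lemma is_polynomial_on_line:
  assumes "is_polynomial p"
  obtains P :: "complex poly" where "\<And>t. p (a + t *s b) = poly P t"
proof -
  obtain M c where p: "p = (\<lambda>x. \<Sum>m\<in>M. c m * monom_fun m x)"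
    using assms unfolding is_polynomial_def by blast
  show thesis
  proof
    show "p (a + t *s b) = poly (\<Sum>m\<in>M. [:c m:] * (\<Prod>i\<in>UNIV. [:a $ i, b $ i:] ^ m i)) t" for t
      unfolding p monom_fun_def by (simp add: poly_sum poly_prod mult.commute)
  qed
qed

text \<open>On the line through \<open>a\<close> and \<open>b\<close> the restriction of
  \<open>p\<close> is nonzero at 0 and that of \<open>q\<close> at 1, so the product of these
  univariate polynomials is not zero.\<close>

lemma is_polynomial_common_nonzero:
  assumes "is_polynomial p" "is_polynomial q" "p a \<noteq> 0" "q b \<noteq> 0"
  obtains x where "p x \<noteq> 0" "q x \<noteq> 0"
proof -
  obtain P where P: "\<And>t. p (a + t *s (b - a)) = poly P t"
    by (rule is_polynomial_on_line[OF assms(1)]) blast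
  obtain Q where Q: "\<And>t. q (a + t *s (b - a)) = poly Q t"
    by (rule is_polynomial_on_line[OF assms(2)]) blast
  have "P \<noteq> 0" using P[of 0] assms(3) by auto
  moreover have "Q \<noteq> 0" using Q[of 1] assms(4) by auto
  ultimately have "P * Q \<noteq> 0" by simp
  then obtain t where "poly (P * Q) t \<noteq> 0" using poly_all_0_iff_0 by blast
  then show thesis using that[of "a + t *s (b - a)"] P Q by auto
qed

text \<open>Otherwise \<open>p - q\<close> and \<open>h\<close> would be nonzero at a common point.
  This carries identities from general points to all points.\<close>

lemma is_polynomial_eqI:
  assumes "is_polynomial p" "is_polynomial q" "is_polynomial h" "h a \<noteq> 0"
    "\<And>x. h x \<noteq> 0 \<Longrightarrow> p x = q x"
  shows "p x = q x"
proof (rule ccontr)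
  assume "p x \<noteq> q x"
  then obtain y where "h y \<noteq> 0" "p y - q y \<noteq> 0"
    using is_polynomial_common_nonzero[OF assms(3) is_polynomial_minus[OF assms(1,2)] assms(4)]
    by auto
  then show False using assms(5) by auto
qed

text \<open>A composite of two quadratic maps has degree at most 4 along a line; only its
  coefficients of \<open>t\<close> and \<open>t\<^sup>2\<close> are read off later.\<close>

lemma vec_polynomial_coeffs_eq_0:
  fixes a0 a1 a2 a3 a4 :: "complex^'n::finite"
  assumes "\<And>t. a0 + t *s a1 + t\<^sup>2 *s a2 + t^3 *s a3 + t^4 *s a4 = 0"
  shows "a1 = 0" "a2 = 0"
proof -
  have "[:a0 $ i, a1 $ i, a2 $ i, a3 $ i, a4 $ i:] = 0" for i
  proof -
    have "poly [:a0 $ i, a1 $ i, a2 $ i, a3 $ i, a4 $ i:] t = 0" for t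
      using arg_cong[OF assms[of t], of "\<lambda>v. v $ i"]
      by (simp add: algebra_simps power2_eq_square power3_eq_cube power4_eq_xxxx)
    then show ?thesis using poly_all_0_iff_0 by blast
  qed
  then show "a1 = 0" "a2 = 0" by (auto simp: vec_eq_iff)
qed

section \<open>Quadratic maps\<close>

text \<open>There is no factor 1/2, so for a quadratic map \<open>polar F x x\<close> is twice
  \<open>F x\<close>.\<close>

definition polar :: "(complex^'n::finite \<Rightarrow> complex^'m::finite) \<Rightarrow> complex^'n \<Rightarrow> complex^'n \<Rightarrow> complex^'m"
  where "polar F x y = F (x + y) - F x - F y"

lemma polar_commute: "polar F x y = polar F y x"
  by (simp add: polar_def add.commute)

locale quadratic_map =
  fixes F :: "complex^'n::finite \<Rightarrow> complex^'m::finite"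
  assumes scale: "F (c *s x) = c\<^sup>2 *s F x"
    and polar_add: "polar F x (y + z) = polar F x y + polar F x z"
    and polar_scale: "polar F x (c *s y) = c *s polar F x y"
begin

lemma polar_add_left: "polar F (x + y) z = polar F x z + polar F y z"
  using polar_add[of z x y] by (simp only: polar_commute[of F z])

lemma polar_scale_left: "polar F (c *s x) y = c *s polar F x y"
  using polar_scale[of y c x] by (simp only: polar_commute[of F y])

lemma polar_diff: "polar F x (y - z) = polar F x y - polar F x z"
  using polar_add[of x "y - z" z] by simp

lemma polar_diff_left: "polar F (x - y) z = polar F x z - polar F y z"
  using polar_diff[of z x y] by (simp only: polar_commute[of F z])

lemma add: "F (x + y) = F x + polar F x y + F y"
  by (simp add: polar_def)

lemma diff: "F (x - y) = F x - polar F x y + F y"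
  using add[of x "-1 *s y"] polar_scale[of x "-1" y] scale[of "-1" y] by simp

lemma polar_self: "polar F x x = 2 *s F x"
proof -
  have "x + x = 2 *s x" by (simp add: vec_eq_iff)
  then show ?thesis unfolding polar_def by (simp add: scale) (simp add: vec_eq_iff)
qed

lemma zero: "F 0 = 0"
  using scale[of 0 0] by simp

lemmas expand = add diff scale polar_add polar_add_left polar_diff polar_diff_left
  polar_scale polar_scale_left polar_self

end

text \<open>Splitting off a variable twice gives each component constant coefficients
  \<open>c k i j\<close>, from which bilinearity of the polarization is visible.\<close>

lemma form_tuple_quadratic_map:
  fixes F :: "complex^'n::finite \<Rightarrow> complex^'m::finite"
  assumes "form_tuple 2 F"
  shows "quadratic_map F"
proof -
  have "\<forall>k. \<exists>c. \<forall>x. F x $ k = (\<Sum>i\<in>UNIV. \<Sum>j\<in>UNIV. c i j * (x $ i * x $ j))"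
  proof
    fix k
    have "is_form (Suc 1) (\<lambda>x. F x $ k)" using assms by (simp add: form_tuple_def numeral_2_eq_2)
    then obtain q where q: "\<And>i. is_form 1 (q i)" "\<And>x. F x $ k = (\<Sum>i\<in>UNIV. x $ i * q i x)"
      by (rule is_form_Suc_decompose) blast
    have "\<forall>i. \<exists>c. \<forall>x. q i x = (\<Sum>j\<in>UNIV. x $ j * c j)"
    proof
      fix i
      have "is_form (Suc 0) (q i)" using q(1) by simp
      then obtain r where r: "\<And>j. is_form 0 (r j)" "\<And>x. q i x = (\<Sum>j\<in>UNIV. x $ j * r j x)"
        by (rule is_form_Suc_decompose) blast
      \<comment> \<open>A form of degree 0 is constant, so its value at 0 is the
        coefficient.\<close>
      have "q i x = (\<Sum>j\<in>UNIV. x $ j * r j 0)" for x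
        unfolding r(2) by (intro sum.cong refl arg_cong[where f = "(*) _"] is_form_0_const r(1))
      then show "\<exists>c. \<forall>x. q i x = (\<Sum>j\<in>UNIV. x $ j * c j)"
        by (intro exI[of _ "\<lambda>j. r j 0"] allI)
    qed
    from choice[OF this]
    obtain c where c: "\<And>i x. q i x = (\<Sum>j\<in>UNIV. x $ j * c i j)" by blast
    show "\<exists>c. \<forall>x. F x $ k = (\<Sum>i\<in>UNIV. \<Sum>j\<in>UNIV. c i j * (x $ i * x $ j))"
      unfolding q(2) c sum_distrib_left by (intro exI[of _ c]) (simp add: mult_ac)
  qed
  from choice[OF this]
  obtain c where c: "\<And>k x. F x $ k = (\<Sum>i\<in>UNIV. \<Sum>j\<in>UNIV. c k i j * (x $ i * x $ j))"
    by blast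
  have p: "polar F x y $ k = (\<Sum>i\<in>UNIV. \<Sum>j\<in>UNIV. c k i j * (x $ i * y $ j + y $ i * x $ j))"
    for x y k
    unfolding polar_def vector_minus_component c sum_subtractf[symmetric]
    by (intro sum.cong refl) (simp add: algebra_simps)
  show ?thesis
  proof
    show "F (a *s x) = a\<^sup>2 *s F x" for a x
      unfolding vec_eq_iff vector_smult_component c sum_distrib_left
      by (simp add: power2_eq_square mult_ac)
    show "polar F x (y + z) = polar F x y + polar F x z" for x y z
      unfolding vec_eq_iff vector_add_component p sum.distrib[symmetric]
      by (intro allI sum.cong refl) (simp add: algebra_simps)
    show "polar F x (a *s y) = a *s polar F x y" for x y a
      unfolding vec_eq_iff vector_smult_component p sum_distrib_left
      by (intro allI sum.cong refl) (simp add: algebra_simps)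
  qed
qed

lemma quadratic_map_compose_linear:
  assumes "quadratic_map F" "Vector_Spaces.linear (*s) (*s) \<phi>"
  shows "quadratic_map (\<lambda>x. \<phi> (F x))"
proof -
  interpret quadratic_map F by fact
  interpret l: Vector_Spaces.linear "(*s)" "(*s)" \<phi> by fact
  have "polar (\<lambda>x. \<phi> (F x)) x y = \<phi> (polar F x y)" for x y
    by (simp add: polar_def l.diff)
  then show ?thesis
    by unfold_locales (simp_all add: scale polar_add polar_scale l.scale l.add)
qed

lemma quadratic_map_precompose_linear:
  assumes "quadratic_map F" "Vector_Spaces.linear (*s) (*s) \<phi>"
  shows "quadratic_map (\<lambda>x. F (\<phi> x))"
proof -
  interpret quadratic_map F by fact
  interpret l: Vector_Spaces.linear "(*s)" "(*s)" \<phi> by fact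
  have "polar (\<lambda>x. F (\<phi> x)) x y = polar F (\<phi> x) (\<phi> y)" for x y
    by (simp add: polar_def l.add)
  then show ?thesis
    by unfold_locales (simp_all add: scale polar_add polar_scale l.scale l.add)
qed

section \<open>Linear forms and the expansion of a cubic form\<close>

lemma is_form_linear:
  fixes f :: "complex^'n::finite \<Rightarrow> complex"
  assumes "\<And>x y. f (x + y) = f x + f y" "\<And>c x. f (c *s x) = c * f x"
  shows "is_form 1 f"
proof -
  have sum: "f (\<Sum>i\<in>I. g i) = (\<Sum>i\<in>I. f (g i))" if "finite I" for I :: "'n set" and g
    using that assms(2)[of 0 0] by (induction I rule: finite_induct) (auto simp: assms(1))
  define a where "a = (\<lambda>i. f (axis i 1))"
  have "f x = (\<Sum>i\<in>UNIV. a i * x $ i)" for x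
  proof -
    have "f x = f (\<Sum>i\<in>UNIV. x $ i *s axis i 1)" by (simp add: basis_expansion)
    also have "\<dots> = (\<Sum>i\<in>UNIV. a i * x $ i)" by (simp add: sum assms(2) a_def mult.commute)
    finally show ?thesis .
  qed
  then have "f = (\<lambda>x. \<Sum>i\<in>UNIV. a i * x $ i)" by blast
  moreover have "is_form 1 (\<lambda>x. \<Sum>i\<in>UNIV. a i * x $ i)"
    by (intro is_form_sum is_form_scale is_form_coord)
  ultimately show ?thesis by simp
qed

lemma form_tuple_linear:
  assumes "Vector_Spaces.linear (*s) (*s) \<phi>"
  shows "form_tuple 1 \<phi>"
proof -
  interpret l: Vector_Spaces.linear "(*s)" "(*s)" \<phi> by fact
  show ?thesis unfolding form_tuple_def
    by (intro allI is_form_linear) (auto simp: l.add l.scale)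
qed

lemma form_tuple_compose:
  assumes "form_tuple d F" "form_tuple k G"
  shows "form_tuple (d * k) (\<lambda>x. F (G x))"
  using assms(1) is_form_compose[OF _ assms(2), of d "\<lambda>x. F x $ i" for i]
  unfolding form_tuple_def by simp

text \<open>The coefficient of \<open>s\<^sup>2 t\<close> is the derivative of \<open>N\<close> at \<open>e\<close>.\<close>

lemma cubic_form_expand:
  fixes N :: "complex^'n::finite \<Rightarrow> complex"
  assumes "is_form 3 N"
  obtains \<tau> S where
    "\<And>x y. \<tau> (x + y) = \<tau> x + \<tau> y" "\<And>c x. \<tau> (c *s x) = c * \<tau> x" "is_form 2 S"
    "\<And>s t w. N (s *s e + t *s w) = s^3 * N e + s\<^sup>2 * t * \<tau> w + s * t\<^sup>2 * S w + t^3 * N w"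
proof -
  have "is_form (Suc 2) N" using assms by (simp add: numeral_3_eq_3 numeral_2_eq_2)
  then obtain q where q: "\<And>i. is_form 2 (q i)" "\<And>x. N x = (\<Sum>i\<in>UNIV. x $ i * q i x)"
    by (rule is_form_Suc_decompose) blast
  define Q :: "complex^'n \<Rightarrow> complex^'n" where "Q = (\<lambda>x. \<chi> i. q i x)"
  interpret quadratic_map Q
    by (rule form_tuple_quadratic_map) (simp add: form_tuple_def Q_def q(1))
  have N: "N x = (\<Sum>i\<in>UNIV. x $ i * Q x $ i)" for x by (simp add: Q_def q(2))
  \<comment> \<open>With \<open>N x\<close> written as the sum of the
    \<open>x $ i * Q x $ i\<close>, these are the coefficients of \<open>s\<^sup>2 * t\<close> and
    \<open>s * t\<^sup>2\<close> after expanding \<open>Q (s *s e + t *s w)\<close>.\<close>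
  define \<tau> where "\<tau> = (\<lambda>w. \<Sum>i\<in>UNIV. e $ i * polar Q e w $ i + w $ i * Q e $ i)"
  define S where "S = (\<lambda>w. \<Sum>i\<in>UNIV. e $ i * Q w $ i + w $ i * polar Q e w $ i)"
  show thesis
  proof
    show "\<tau> (x + y) = \<tau> x + \<tau> y" for x y
      unfolding \<tau>_def sum.distrib[symmetric] by (simp add: polar_add algebra_simps)
    show "\<tau> (c *s x) = c * \<tau> x" for c x
      unfolding \<tau>_def sum_distrib_left by (simp add: polar_scale algebra_simps)
    have "is_form 1 (\<lambda>w. polar Q e w $ i)" for i
      by (rule is_form_linear) (simp_all add: polar_add polar_scale)
    from is_form_mult[OF is_form_coord this]
    have "is_form 2 (\<lambda>w. w $ i * polar Q e w $ i)" for i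
      by (simp add: numeral_2_eq_2)
    then show "is_form 2 S"
      unfolding S_def by (intro is_form_sum is_form_add is_form_scale) (simp_all add: Q_def q(1))
    show "N (s *s e + t *s w) = s^3 * N e + s\<^sup>2 * t * \<tau> w + s * t\<^sup>2 * S w + t^3 * N w" for s t w
      unfolding N S_def \<tau>_def sum_distrib_left sum.distrib[symmetric]
      by (intro sum.cong refl) (simp add: expand algebra_simps power2_eq_square power3_eq_cube)
  qed
qed

text \<open>A quadratic map sends a line to a curve of this kind, so this expands the outer map of a
  composite of two quadratic maps along a line.\<close>

lemma (in quadratic_map) curve:
  "F (a + t *s b + t\<^sup>2 *s c) =
     F a + t *s polar F a b + t\<^sup>2 *s (F b + polar F a c) + t^3 *s polar F b c + t^4 *s F c"
  by (simp add: expand vec_eq_iff)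
     (simp add: algebra_simps power2_eq_square power3_eq_cube power4_eq_xxxx)

section \<open>Mutually inverse quadratic maps normalized at a point\<close>

text \<open>Both maps fix \<open>e\<close> and have there the polarization of the adjoint of a cubic
  algebra with unity \<open>e\<close> and trace \<open>\<tau>\<close>. The two cubics have the same
  derivative \<open>\<tau>\<close> at \<open>e\<close>; their quadratic terms \<open>S\<close> and
  \<open>S'\<close> may differ at first.\<close>

locale normalized_pair =
  Q: quadratic_map Q + R: quadratic_map R
  for Q R :: "complex^'n::finite \<Rightarrow> complex^'n" +
  fixes e :: "complex^'n" and N N' \<tau> S S' :: "complex^'n \<Rightarrow> complex"
  assumes e_nonzero: "e \<noteq> 0"
    and \<tau>_add: "\<tau> (x + y) = \<tau> x + \<tau> y"
    and \<tau>_scale: "\<tau> (c *s x) = c * \<tau> x"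
    and RQ: "R (Q x) = N x *s x"
    and QR: "Q (R x) = N' x *s x"
    and Q_e: "Q e = e"
    and R_e: "R e = e"
    and polar_Q_e: "polar Q e v = \<tau> v *s e - v"
    and polar_R_e: "polar R e v = \<tau> v *s e - v"
    and N_expand: "N (s *s e + t *s w) = s^3 + s\<^sup>2 * t * \<tau> w + s * t\<^sup>2 * S w + t^3 * N w"
    and N'_expand: "N' (s *s e + t *s w) = s^3 + s\<^sup>2 * t * \<tau> w + s * t\<^sup>2 * S' w + t^3 * N' w"
begin

lemma \<tau>_diff: "\<tau> (x - y) = \<tau> x - \<tau> y"
  using \<tau>_add[of "x - y" y] by simp

lemma \<tau>_e: "\<tau> e = 3"
proof -
  have "(\<tau> e - 3) *s e = 0"
    using polar_Q_e[of e] Q.polar_self[of e] Q_e by (simp add: vec_eq_iff algebra_simps)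
  then show ?thesis using e_nonzero by simp
qed

lemma polar_Q_e': "polar Q v e = \<tau> v *s e - v"
  using polar_Q_e polar_commute by metis

text \<open>The coefficient of \<open>t\<^sup>2\<close> in \<open>Q (R (e + t w)) = N' (e + t w) (e + t w)\<close>.\<close>

lemma Q_minus_R: "Q w - R w = (S' w - \<tau> (R w)) *s e"
proof -
  define b where "b = \<tau> w *s e - w"
  have Rt: "R (e + t *s w) = e + t *s b + t\<^sup>2 *s R w" for t
    by (simp add: R.expand R_e polar_R_e b_def)
  have N't: "N' (e + t *s w) = 1 + t * \<tau> w + t\<^sup>2 * S' w + t^3 * N' w" for t
    using N'_expand[of 1 t w] by simp
  \<comment> \<open>The constant term is 0 because \<open>Q e\<close> cancels against
    \<open>e\<close>.\<close>
  have "0 + t *s (polar Q e b - (\<tau> w *s e + w)) + t\<^sup>2 *s (Q b + polar Q e (R w) - (S' w *s e + \<tau> w *s w))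
      + t^3 *s (polar Q b (R w) - (N' w *s e + S' w *s w)) + t^4 *s (Q (R w) - N' w *s w) = 0" for t
  proof -
    have "Q e + t *s polar Q e b + t\<^sup>2 *s (Q b + polar Q e (R w)) + t^3 *s polar Q b (R w)
        + t^4 *s Q (R w) = N' (e + t *s w) *s (e + t *s w)"
      using QR[of "e + t *s w"] unfolding Rt Q.curve .
    then show ?thesis
      unfolding N't Q_e
      by (simp add: vec_eq_iff) (simp add: algebra_simps power2_eq_square power3_eq_cube power4_eq_xxxx)
  qed
  from vec_polynomial_coeffs_eq_0(2)[OF this]
  have "Q b + polar Q e (R w) = S' w *s e + \<tau> w *s w" by simp
  \<comment> \<open>The summand \<open>\<tau> w *s w\<close> cancels the one in the previous
    identity, so only multiples of \<open>e\<close> remain besides \<open>Q w - R w\<close>.\<close>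
  moreover have "Q b = \<tau> w *s w + Q w"
    unfolding b_def by (simp add: Q.expand Q_e polar_Q_e vec_eq_iff algebra_simps power2_eq_square)
  ultimately show ?thesis
    unfolding polar_Q_e by (simp add: vec_eq_iff algebra_simps)
qed

text \<open>The coefficient of \<open>t\<close> in \<open>R (Q (w + t e)) = N (w + t e) (w + t e)\<close>.\<close>

lemma polar_R_Q: "polar R (Q w) (\<tau> w *s e - w) = S w *s w + N w *s e"
proof -
  define b where "b = \<tau> w *s e - w"
  have Qt: "Q (w + t *s e) = Q w + t *s b + t\<^sup>2 *s e" for t
    by (simp add: Q.expand Q_e polar_Q_e' b_def)
  have Nt: "N (w + t *s e) = N w + t * S w + t\<^sup>2 * \<tau> w + t^3" for t
    using N_expand[of t 1 w] by (simp add: add.commute add.left_commute)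
  have "0 + t *s (polar R (Q w) b - (S w *s w + N w *s e))
      + t\<^sup>2 *s (R b + polar R (Q w) e - (\<tau> w *s w + S w *s e))
      + t^3 *s (polar R b e - (w + \<tau> w *s e)) + t^4 *s 0 = 0" for t
  proof -
    have "R (Q w) + t *s polar R (Q w) b + t\<^sup>2 *s (R b + polar R (Q w) e) + t^3 *s polar R b e
        + t^4 *s R e = N (w + t *s e) *s (w + t *s e)"
      using RQ[of "w + t *s e"] unfolding Qt R.curve .
    then show ?thesis
      unfolding Nt R_e RQ
      by (simp add: vec_eq_iff) (simp add: algebra_simps power2_eq_square power3_eq_cube power4_eq_xxxx)
  qed
  from vec_polynomial_coeffs_eq_0(1)[OF this] show ?thesis by (simp add: b_def)
qed

lemma R_eq_Q_generic:
  assumes "\<And>a b. Q w \<noteq> a *s e + b *s w"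
  shows "R w = Q w"
proof -
  \<comment> \<open>\<open>Q_minus_R\<close> is used at \<open>w\<close> and at \<open>Q w\<close>;
    then \<open>Q (R w)\<close> is computed in two ways.\<close>
  define \<epsilon> \<epsilon>' where "\<epsilon> = S' w - \<tau> (R w)" and "\<epsilon>' = S' (Q w) - \<tau> (R (Q w))"
  have Rw: "R w = Q w - \<epsilon> *s e"
    using Q_minus_R[of w] by (simp add: \<epsilon>_def algebra_simps)
  have "Q (Q w) = N w *s w + \<epsilon>' *s e"
    using Q_minus_R[of "Q w"] unfolding RQ \<epsilon>'_def by (simp add: algebra_simps)
  moreover have "Q (R w) = \<epsilon>\<^sup>2 *s e - \<epsilon> *s (\<tau> (Q w) *s e - Q w) + Q (Q w)"
    unfolding Rw by (simp add: Q.expand Q_e polar_Q_e' algebra_simps)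
  ultimately have *: "\<epsilon> *s Q w = (\<epsilon> * \<tau> (Q w) - \<epsilon>' - \<epsilon>\<^sup>2) *s e + (N' w - N w) *s w"
    unfolding QR by (simp add: vec_eq_iff algebra_simps)
  have "\<epsilon> = 0"
  proof (rule ccontr)
    assume "\<epsilon> \<noteq> 0"
    have "Q w = (1 / \<epsilon>) *s (\<epsilon> *s Q w)" using \<open>\<epsilon> \<noteq> 0\<close> by simp
    also have "\<dots> = ((\<epsilon> * \<tau> (Q w) - \<epsilon>' - \<epsilon>\<^sup>2) / \<epsilon>) *s e + ((N' w - N w) / \<epsilon>) *s w"
      unfolding * using \<open>\<epsilon> \<noteq> 0\<close> by (simp add: vec_eq_iff field_simps)
    finally show False using assms by blast
  qed
  then show ?thesis using Rw by simp
qed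

text \<open>If \<open>Q v = a e + b v\<close>, then \<open>Q\<close> maps \<open>b e + v\<close> to \<open>(b\<^sup>2 + b \<tau> v + a) e\<close>, which \<open>R\<close> would
  map to a multiple of \<open>e\<close> rather than of \<open>b e + v\<close>.\<close>

lemma collinear_coefficient:
  assumes v: "\<And>c. v \<noteq> c *s e" and Qv: "Q v = a *s e + b *s v"
  shows "a = - b\<^sup>2 - b * \<tau> v"
proof -
  define \<delta> where "\<delta> = b\<^sup>2 + b * \<tau> v + a"
  have "Q (b *s e + v) = \<delta> *s e"
    by (simp add: Q.expand Q_e polar_Q_e' Qv \<delta>_def vec_eq_iff algebra_simps)
  then have *: "\<delta>\<^sup>2 *s e = N (b *s e + v) *s (b *s e + v)"
    using RQ[of "b *s e + v"] R.scale R_e by metis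
  \<comment> \<open>Otherwise the preceding equation would make \<open>v\<close> a multiple of
    \<open>e\<close>.\<close>
  have "N (b *s e + v) = 0"
  proof (rule ccontr)
    assume n: "N (b *s e + v) \<noteq> 0"
    have "v = (1 / N (b *s e + v)) *s (N (b *s e + v) *s (b *s e + v)) - b *s e"
      using n by simp
    also have "\<dots> = (\<delta>\<^sup>2 / N (b *s e + v) - b) *s e"
      unfolding *[symmetric] by (simp add: vec_eq_iff algebra_simps)
    finally show False using v by blast
  qed
  then have "\<delta> = 0" using * e_nonzero by simp
  then show ?thesis by (simp add: \<delta>_def algebra_simps eq_neg_iff_add_eq_0)
qed

lemma collinear_unique:
  assumes v: "\<And>c. v \<noteq> c *s e" and eq: "a *s e + b *s v = a' *s e + b' *s v"
  shows "b = b'"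
proof (rule ccontr)
  assume "b \<noteq> b'"
  have "v $ i = (a' - a) / (b - b') * e $ i" for i
  proof -
    have "(b - b') * v $ i = (a' - a) * e $ i"
      using arg_cong[OF eq, of "\<lambda>x. x $ i"] by (simp add: algebra_simps)
    then show ?thesis using \<open>b \<noteq> b'\<close> by (simp add: eq_divide_eq mult.commute)
  qed
  then have "v = ((a' - a) / (b - b')) *s e" by (simp add: vec_eq_iff)
  then show False using v by blast
qed

text \<open>The coefficient \<open>l v\<close> of \<open>v\<close> in \<open>Q v\<close> is shown to
  be linear: \<open>polar_Q_e'\<close> handles multiples of \<open>e\<close>, and the parallelogram
  identity gives additivity. \<open>collinear_coefficient\<close> then exhibits \<open>l\<close> as
  a factor of \<open>Q\<close>.\<close>

lemma collinear_imp_linear_factor: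
  assumes dep: "\<And>v. \<exists>a b. Q v = a *s e + b *s v"
  obtains l where "\<And>x y. l (x + y) = l x + l y" "\<And>c x. l (c *s x) = c * l x" "l e = -1"
    "\<And>v. Q v = l v *s (v - (l v + \<tau> v) *s e)"
proof -
  \<comment> \<open>On the line of \<open>e\<close> the coefficient is ambiguous; the value
    \<open>- c\<close> at \<open>c *s e\<close> is the one that makes \<open>l\<close>
    linear.\<close>
  define P where "P = (\<lambda>v b. if \<exists>c. v = c *s e then v = (- b) *s e else \<exists>a. Q v = a *s e + b *s v)"
  define l where "l = (\<lambda>v. SOME b. P v b)"
  have "\<exists>b. P v b" for v
  proof (cases "\<exists>c. v = c *s e")
    case True
    then obtain c where "v = c *s e" by blast
    then show ?thesis unfolding P_def by (intro exI[of _ "- c"]) auto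
  next
    case False
    then show ?thesis using dep[of v] unfolding P_def by auto
  qed
  then have Pl: "P v (l v)" for v unfolding l_def by (rule someI_ex)
  have uniq: "b = l v" if Pb: "P v b" for v b
  proof (cases "\<exists>c. v = c *s e")
    case True
    then show ?thesis using that Pl[of v] e_nonzero unfolding P_def by auto
  next
    case False
    then obtain a where a: "Q v = a *s e + b *s v" using Pb False unfolding P_def by auto
    obtain a' where "Q v = a' *s e + l v *s v" using False Pl[of v] unfolding P_def by auto
    then show ?thesis using a False collinear_unique[of v a b a' "l v"] by auto
  qed
  have mult: "l (c *s e) = - c" for c
    using uniq[of "c *s e" "- c"] unfolding P_def by auto
  have Ql: "\<exists>a. Q v = a *s e + l v *s v" if "\<And>c. v \<noteq> c *s e" for v
    using Pl[of v] that unfolding P_def by auto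
  have lI: "l v = b" if "\<And>c. v \<noteq> c *s e" "Q v = a *s e + b *s v" for v a b
    using uniq[of v b] that unfolding P_def by auto
  have comb: "l (c *s v + d *s e) = c * l v - d" for c d v
  proof (cases "\<exists>k. v = k *s e")
    case True
    then obtain k where k: "v = k *s e" by blast
    have "c *s v + d *s e = (c * k + d) *s e" unfolding k by (simp add: vec.scale_left_distrib)
    then have "l (c *s v + d *s e) = - (c * k + d)" by (simp only: mult)
    then show ?thesis using mult k by simp
  next
    case False
    show ?thesis
    proof (cases "c = 0")
      case True
      then show ?thesis using mult by simp
    next
      case c: False
      have nc: "c *s v + d *s e \<noteq> k *s e" for k
      proof
        assume "c *s v + d *s e = k *s e"
        then have "c *s v = (k - d) *s e" by (simp add: vec.scale_left_diff_distrib eq_diff_eq)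
        then have "(1 / c) *s (c *s v) = (1 / c) *s ((k - d) *s e)" by simp
        then have "v = (k / c - d / c) *s e" using c by simp
        then show False using False by blast
      qed
      obtain a where a: "Q v = a *s e + l v *s v" using Ql False by blast
      \<comment> \<open>Translation by \<open>d *s e\<close> contributes
        \<open>- (c * d) *s v\<close>, which lowers the coefficient of the new vector by
        \<open>d\<close>.\<close>
      have "Q (c *s v + d *s e) =
        (c\<^sup>2 * a + c * d * \<tau> v + d\<^sup>2 - d * (c * l v - d)) *s e + (c * l v - d) *s (c *s v + d *s e)"
        by (simp add: Q.expand Q_e polar_Q_e' \<tau>_scale a vec_eq_iff algebra_simps power2_eq_square)
      from lI[OF nc this] show ?thesis .
    qed
  qed
  have scale: "l (c *s x) = c * l x" for c x
    using comb[of c x 0] by simp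
  have add: "l (v + w) = l v + l w" for v w
  proof (cases "\<exists>c d. w = c *s v + d *s e")
    case True
    then obtain c d where w: "w = c *s v + d *s e" by blast
    have "v + w = (c + 1) *s v + d *s e" unfolding w by (simp add: vec_eq_iff algebra_simps)
    then have "l (v + w) = (c + 1) * l v - d" by (simp only: comb)
    then show ?thesis unfolding w comb by (simp add: algebra_simps)
  next
    case w: False
    show ?thesis
    proof (cases "\<exists>k. v = k *s e")
      case True
      then obtain k where k: "v = k *s e" by blast
      have "v + w = 1 *s w + k *s e" unfolding k by simp
      then show ?thesis using comb[of 1 w k] mult unfolding k by (simp add: add.commute)
    next
      case v: False
      \<comment> \<open>In the remaining case \<open>e\<close>, \<open>v\<close> and
        \<open>w\<close> are independent; only the coefficients of \<open>v\<close> and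
        \<open>w\<close> will be compared.\<close>
      have indep: "b = 0 \<and> c = 0" if eq: "a *s e + b *s v + c *s w = 0" for a b c
      proof -
        have "c = 0"
        proof (rule ccontr)
          assume "c \<noteq> 0"
          have "w = (1 / c) *s (c *s w)" using \<open>c \<noteq> 0\<close> by simp
          also have "c *s w = (- b) *s v + (- a) *s e"
            using eq by (simp add: vec_eq_iff algebra_simps) (metis add.commute add_eq_0_iff minus_add_distrib uminus_add_conv_diff)
          finally have "w = (- b / c) *s v + (- a / c) *s e"
            by (simp add: vec.scale_right_distrib vec.scale_right_diff_distrib)
          then show False using w by blast
        qed
        moreover have "b = 0"
        proof (rule ccontr)
          assume "b \<noteq> 0"
          have "v = (1 / b) *s (b *s v)" using \<open>b \<noteq> 0\<close> by simp
          also have "b *s v = (- a) *s e"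
            using eq \<open>c = 0\<close> by (simp add: vec_eq_iff algebra_simps) (metis add.commute add_eq_0_iff)
          finally have "v = (- a / b) *s e" by simp
          then show False using v by blast
        qed
        ultimately show ?thesis by simp
      qed
      have nz: "v + k *s w \<noteq> c *s e" for c k
        using indep[of "- c" 1 k] by (auto simp: vec_eq_iff algebra_simps)
      have "w \<noteq> c *s e" for c
        using w by (metis add_0 vec.scale_zero_left)
      then obtain a2 where a2: "Q w = a2 *s e + l w *s w" using Ql by blast
      obtain a1 where a1: "Q v = a1 *s e + l v *s v" using Ql v by blast
      obtain a3 where a3: "Q (v + w) = a3 *s e + l (v + w) *s (v + w)"
        using Ql nz[of 1] by (metis vec.scale_one)
      obtain a4 where a4: "Q (v - w) = a4 *s e + l (v - w) *s (v - w)"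
        using Ql nz[of "-1"] by (metis vec.scale_minus_left vec.scale_one uminus_add_conv_diff add.commute)
      \<comment> \<open>The parallelogram identity yields two equations for \<open>l (v + w)\<close>
        and \<open>l (v - w)\<close>; adding them eliminates the latter.\<close>
      have "Q (v + w) + Q (v - w) = 2 *s Q v + 2 *s Q w"
        by (simp add: Q.add Q.diff vec_eq_iff)
      then have "(a3 + a4 - 2 * a1 - 2 * a2) *s e + (l (v + w) + l (v - w) - 2 * l v) *s v
          + (l (v + w) - l (v - w) - 2 * l w) *s w = 0"
        unfolding a1 a2 a3 a4 by (simp add: vec_eq_iff algebra_simps)
      from indep[OF this] have "l (v + w) + l (v - w) = 2 * l v" "l (v + w) - l (v - w) = 2 * l w"
        by simp_all
      then have "2 * l (v + w) = 2 * (l v + l w)" by algebra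
      then show ?thesis by (simp only: mult_cancel_left) simp
    qed
  qed
  show thesis
  proof
    show "l (x + y) = l x + l y" "l (c *s x) = c * l x" for c x y by (fact add scale)+
    show "l e = -1" using mult[of 1] by simp
    show "Q v = l v *s (v - (l v + \<tau> v) *s e)" for v
    proof (cases "\<exists>k. v = k *s e")
      case True
      then obtain k where k: "v = k *s e" by blast
      show ?thesis
        unfolding k Q.scale Q_e mult \<tau>_scale \<tau>_e
        by (simp add: vec_eq_iff algebra_simps power2_eq_square)
    next
      case False
      then obtain a where a: "Q v = a *s e + l v *s v" using Ql by blast
      have a': "a = - (l v)\<^sup>2 - l v * \<tau> v" using collinear_coefficient[OF _ a] False by blast
      show ?thesis unfolding a a' by (simp add: vec_eq_iff algebra_simps power2_eq_square)
    qed
  qed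
qed

end

section \<open>The rank 3 algebra\<close>

text \<open>In the case \<open>Q = R\<close> the assumption \<open>RQ\<close> becomes the adjoint
  identity \<open>Q (Q x) = N x *s x\<close>, with \<open>Q x\<close> in the role of x#.\<close>

locale adjoint_map = normalized_pair Q Q e N N \<tau> S S
  for Q :: "complex^'n::finite \<Rightarrow> complex^'n" and e N \<tau> S
begin

lemma S_eq: "S w = \<tau> (Q w)"
  using Q_minus_R[of w] e_nonzero by simp

lemma polar_Q_self: "polar Q w (Q w) = (\<tau> w * S w - N w) *s e - \<tau> w *s Q w - S w *s w"
  using polar_R_Q[of w] unfolding Q.polar_diff Q.polar_scale polar_Q_e' S_eq polar_commute[of Q w]
  by (simp add: vec_eq_iff algebra_simps)

text \<open>The polarization, with factor 1/2, of the square x^2 = x# + T(x) x - S(x) e of a cubic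
  algebra; the trace of \<open>Q x\<close> plays the role of S(x).\<close>

definition mul :: "complex^'n \<Rightarrow> complex^'n \<Rightarrow> complex^'n" where
  "mul x y = (1 / 2) *s (polar Q x y + \<tau> x *s y + \<tau> y *s x - \<tau> (polar Q x y) *s e)"

lemma mul_commute: "mul x y = mul y x"
  by (simp add: mul_def polar_commute[of Q x y] algebra_simps)

lemma mul_add: "mul x (y + z) = mul x y + mul x z"
  by (simp add: mul_def Q.polar_add \<tau>_add vec_eq_iff field_simps)

lemma mul_scale: "mul x (c *s y) = c *s mul x y"
  by (simp add: mul_def Q.polar_scale \<tau>_scale vec_eq_iff field_simps)

lemma mul_add_left: "mul (x + y) z = mul x z + mul y z"
  using mul_add[of z x y] by (simp only: mul_commute[of z])

lemma mul_scale_left: "mul (c *s x) y = c *s mul x y"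
  using mul_scale[of y c x] by (simp only: mul_commute[of y])

lemma mul_diff: "mul x (y - z) = mul x y - mul x z"
  using mul_add[of x "y - z" z] by simp

lemma mul_diff_left: "mul (x - y) z = mul x z - mul y z"
  using mul_diff[of z x y] by (simp only: mul_commute[of z])

lemmas mul_linear = mul_add mul_scale mul_add_left mul_scale_left mul_diff mul_diff_left

lemma mul_e: "mul e x = x"
  by (simp add: mul_def polar_Q_e \<tau>_e \<tau>_diff \<tau>_scale vec_eq_iff)

lemma mul_e_right: "mul x e = x"
  by (subst mul_commute) (rule mul_e)

lemma comm_unital_algebra_mul: "comm_unital_algebra mul e"
proof -
  have "Vector_Spaces.linear (*s) (*s) (mul x)" for x
    by unfold_locales (simp_all add: mul_add mul_scale)
  then show ?thesis using mul_commute mul_e unfolding comm_unital_algebra_def by blast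
qed

abbreviation sq :: "complex^'n \<Rightarrow> complex^'n" where "sq x \<equiv> mul x x"

lemma sq_eq: "sq x = Q x + \<tau> x *s x - S x *s e"
  unfolding mul_def Q.polar_self \<tau>_scale S_eq by (simp add: vec_eq_iff field_simps)

text \<open>\<open>polar_Q_self\<close> evaluates the polarization of \<open>x\<close> and
  \<open>Q x\<close>. Its trace, computed with \<open>\<tau> e = 3\<close>, supplies the last
  summand of \<open>mul\<close>, and only \<open>N x *s e\<close> survives.\<close>

lemma mul_Q: "mul x (Q x) = N x *s e"
proof -
  have "\<tau> (polar Q x (Q x)) = \<tau> x * S x - 3 * N x"
    unfolding polar_Q_self \<tau>_diff \<tau>_scale \<tau>_e S_eq by (simp add: algebra_simps)
  then show ?thesis
    unfolding mul_def by (simp only: polar_Q_self) (simp add: S_eq vec_eq_iff field_simps)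
qed

text \<open>This is the Cayley-Hamilton equation: \<open>mul_Q\<close> with \<open>Q x\<close>
  expressed through \<open>sq x\<close>, \<open>x\<close> and \<open>e\<close>.\<close>

lemma mul_sq: "mul x (sq x) = \<tau> x *s sq x - S x *s x + N x *s e"
proof -
  have q: "Q x = sq x - \<tau> x *s x + S x *s e" unfolding sq_eq by simp
  have "mul x (sq x - \<tau> x *s x + S x *s e) = N x *s e" unfolding q[symmetric] by (rule mul_Q)
  then show ?thesis
    by (simp add: mul_linear mul_e_right algebra_simps)
qed

lemma S_Q: "S (Q x) = N x * \<tau> x"
  unfolding S_eq RQ \<tau>_scale ..

text \<open>The square of \<open>Q x\<close> is known from \<open>Q (Q x) = N x *s x\<close>, and
  this yields the product of \<open>sq x\<close> and \<open>Q x\<close>. Both sides then reduce to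
  the cubic equation multiplied by \<open>x\<close>.\<close>

lemma mul_sq_sq: "mul (sq x) (sq x) = mul x (mul x (sq x))"
proof -
  have QQ: "mul (Q x) (Q x) = N x *s x + S x *s Q x - (N x * \<tau> x) *s e"
    unfolding sq_eq[of "Q x"] RQ S_Q by (simp add: S_eq)
  have "mul (sq x) (Q x) = N x *s x"
    unfolding sq_eq[of x] by (simp add: mul_linear mul_e mul_Q QQ vec_eq_iff algebra_simps)
  moreover have "mul (sq x) (sq x) = mul (sq x) (Q x + \<tau> x *s x - S x *s e)"
    using sq_eq[of x] by simp
  ultimately have "mul (sq x) (sq x) = N x *s x + \<tau> x *s mul x (sq x) - S x *s sq x"
    by (simp add: mul_linear mul_e_right mul_commute[of "sq x" x])
  also have "\<dots> = mul x (mul x (sq x))"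
    unfolding mul_sq[of x] by (simp add: mul_linear mul_e_right vec_eq_iff algebra_simps mul_sq)
  finally show ?thesis .
qed

section \<open>The subalgebra generated by one element\<close>

definition comb3 :: "complex^'n \<Rightarrow> complex \<Rightarrow> complex \<Rightarrow> complex \<Rightarrow> complex^'n" where
  "comb3 x a b c = a *s e + b *s x + c *s sq x"

text \<open>This is multiplication of polynomials modulo the cubic of \<open>x\<close>:
  \<open>k3\<close> and \<open>k4\<close> are the coefficients of the third and fourth powers, which
  are reduced by \<open>mul_sq\<close> and \<open>mul_sq_sq\<close>. Associativity thus becomes an
  identity of coefficients, whether or not \<open>e\<close>, \<open>x\<close>, \<open>sq x\<close>
  are independent.\<close>

lemma mul_comb3:
  "mul (comb3 x a b c) (comb3 x a' b' c') =
    (let k3 = b * c' + c * b'; k4 = c * c' in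
     comb3 x
      (a * a' + k3 * N x + k4 * \<tau> x * N x)
      (a * b' + b * a' - k3 * S x + k4 * (N x - \<tau> x * S x))
      (a * c' + b * b' + c * a' + k3 * \<tau> x + k4 * (\<tau> x * \<tau> x - S x)))"
proof -
  have 3: "mul (sq x) x = \<tau> x *s sq x - S x *s x + N x *s e" using mul_sq[of x] by (simp only: mul_commute[of "sq x" x])
  have 4: "mul (sq x) (sq x) =
      (\<tau> x * \<tau> x - S x) *s sq x + (N x - \<tau> x * S x) *s x + (\<tau> x * N x) *s e"
    unfolding mul_sq_sq mul_sq by (simp add: mul_linear mul_e_right mul_sq vec_eq_iff algebra_simps)
  have "mul (comb3 x a b c) (comb3 x a' b' c') =
      (a * a') *s e + (a * b' + b * a') *s x + (a * c' + b * b' + c * a') *s sq x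
      + (b * c' + c * b') *s mul x (sq x) + (c * c') *s mul (sq x) (sq x)"
    unfolding comb3_def mul_add mul_add_left mul_scale mul_scale_left mul_e mul_e_right
      mul_commute[of "sq x" x]
    by (simp add: vec_eq_iff algebra_simps)
  then show ?thesis
    unfolding mul_sq 4 comb3_def Let_def by (simp add: vec_eq_iff algebra_simps)
qed

lemma mul_comb3_assoc:
  "mul (mul (comb3 x a b c) (comb3 x a' b' c')) (comb3 x a'' b'' c'') =
   mul (comb3 x a b c) (mul (comb3 x a' b' c') (comb3 x a'' b'' c''))"
  unfolding mul_comb3 Let_def by (intro arg_cong3[of _ _ _ _ _ _ "comb3 x"]) (simp_all add: algebra_simps)

lemma comb3_basis: "comb3 x 1 0 0 = e" "comb3 x 0 1 0 = x" "comb3 x 0 0 1 = sq x"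
  by (simp_all add: comb3_def)

lemma generated_eq: "generated_subalgebra mul e x = {comb3 x a b c | a b c. True}" (is "_ = ?S")
proof
  have "unital_subalgebra mul e ?S"
    unfolding unital_subalgebra_def
  proof (intro conjI ballI)
    show "vec.subspace ?S"
    proof (rule vec.subspaceI)
      have "0 = comb3 x 0 0 0" by (simp add: comb3_def)
      then show "0 \<in> ?S" by blast
      fix u v assume "u \<in> ?S" "v \<in> ?S"
      then obtain a b c a' b' c' where "u = comb3 x a b c" "v = comb3 x a' b' c'" by blast
      then have "u + v = comb3 x (a + a') (b + b') (c + c')"
        by (simp add: comb3_def vec_eq_iff algebra_simps)
      then show "u + v \<in> ?S" by blast
    next
      fix k u assume "u \<in> ?S"
      then obtain a b c where "u = comb3 x a b c" by blast
      then have "k *s u = comb3 x (k * a) (k * b) (k * c)"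
        by (simp add: comb3_def vec_eq_iff algebra_simps)
      then show "k *s u \<in> ?S" by blast
    qed
    show "e \<in> ?S" using comb3_basis(1)[of x, symmetric] by blast
    fix u v assume "u \<in> ?S" "v \<in> ?S"
    then obtain a b c a' b' c' where uv: "u = comb3 x a b c" "v = comb3 x a' b' c'" by blast
    show "mul u v \<in> ?S" unfolding uv mul_comb3 Let_def by blast
  qed
  moreover have "x \<in> ?S" using comb3_basis(2)[of x, symmetric] by blast
  ultimately show "generated_subalgebra mul e x \<subseteq> ?S"
    unfolding generated_subalgebra_def by (intro hull_minimal) auto
  have "u \<in> T" if "unital_subalgebra mul e T" and x: "x \<in> T" and u: "u \<in> ?S" for u T
  proof -
    have T: "vec.subspace T" "e \<in> T" "sq x \<in> T" using that unfolding unital_subalgebra_def by auto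
    obtain a b c where "u = comb3 x a b c" using u by blast
    then show ?thesis
      using T x unfolding comb3_def by (simp add: vec.subspace_add vec.subspace_scale)
  qed
  then show "?S \<subseteq> generated_subalgebra mul e x"
    unfolding generated_subalgebra_def hull_def by blast
qed

lemma power_associative_mul: "power_associative mul e"
proof -
  have "mul (mul u v) w = mul u (mul v w)"
    if "u \<in> generated_subalgebra mul e x" "v \<in> generated_subalgebra mul e x"
      "w \<in> generated_subalgebra mul e x" for x u v w
    using that unfolding generated_eq by clarify (rule mul_comb3_assoc)
  then show ?thesis unfolding power_associative_def by blast
qed

lemma power_associative_algebra_mul: "power_associative_algebra mul e"
  unfolding power_associative_algebra_def
  using comm_unital_algebra_mul power_associative_mul by blast

end

section \<open>General points, where the unity, a point and its image are independent\<close>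

context normalized_pair
begin

text \<open>The polynomial is a \<open>3 \<times> 3\<close> minor of \<open>(e, x, Q x)\<close>, up to a power of a coordinate of \<open>e\<close>.\<close>

lemma generic_noncollinear:
  assumes Qpoly: "\<And>i. is_polynomial (\<lambda>x. Q x $ i)" and w: "\<And>a b. Q w \<noteq> a *s e + b *s w"
  obtains p where "is_polynomial p" "p w \<noteq> 0"
    "\<And>x a b. p x \<noteq> 0 \<Longrightarrow> Q x \<noteq> a *s e + b *s x"
proof -
  obtain k where k: "e $ k \<noteq> 0" using e_nonzero by (auto simp: vec_eq_iff)
  \<comment> \<open>\<open>L\<close> is linear with kernel the line of \<open>e\<close>. As
    \<open>L w\<close> is nonzero, \<open>Q w\<close> lies in the span of \<open>e\<close> and
    \<open>w\<close> iff \<open>L (Q w)\<close> is a multiple of \<open>L w\<close>.\<close>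
  define L where "L = (\<lambda>x. e $ k *s x - x $ k *s e)"
  have L_eq_0: "x = (x $ k / e $ k) *s e" if "L x = 0" for x
    using that k unfolding L_def by (simp add: vec_eq_iff field_simps)
  have "L w \<noteq> 0"
  proof
    assume "L w = 0"
    then obtain c where "w = c *s e" using L_eq_0 by blast
    then have "Q w = c\<^sup>2 *s e + 0 *s w" by (simp add: Q.scale Q_e)
    then show False using w by blast
  qed
  then obtain j where j: "L w $ j \<noteq> 0" by (auto simp: vec_eq_iff)
  define M where "M = L w $ j *s L (Q w) - L (Q w) $ j *s L w"
  have "M \<noteq> 0"
  proof
    assume M0: "M = 0"
    define b where "b = L (Q w) $ j / L w $ j"
    have "L (Q w - b *s w) = L (Q w) - b *s L w"
      unfolding L_def by (simp add: vec_eq_iff algebra_simps)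
    also have "\<dots> = (1 / L w $ j) *s M"
      using j unfolding M_def b_def by (simp add: vec_eq_iff field_simps)
    also have "\<dots> = 0" by (simp add: M0)
    finally obtain a where "Q w - b *s w = a *s e" using L_eq_0 by blast
    then have "Q w = a *s e + b *s w" by (simp add: diff_eq_eq)
    then show False using w by blast
  qed
  then obtain i where i: "M $ i \<noteq> 0" by (auto simp: vec_eq_iff)
  show thesis
  proof
    let ?p = "\<lambda>x. L x $ j * L (Q x) $ i - L (Q x) $ j * L x $ i"
    show "?p w \<noteq> 0" using i by (simp add: M_def)
    have "is_polynomial (\<lambda>x. L x $ i)" "is_polynomial (\<lambda>x. L (Q x) $ i)" for i
      unfolding L_def vector_minus_component vector_smult_component
      by (intro is_polynomial_minus is_polynomial_mult is_polynomial_const is_polynomial_coord Qpoly)+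
    then show "is_polynomial ?p"
      by (intro is_polynomial_minus is_polynomial_mult)
    show "Q x \<noteq> a *s e + b *s x" if "?p x \<noteq> 0" for x a b
    proof
      assume "Q x = a *s e + b *s x"
      then have "L (Q x) = b *s L x" unfolding L_def by (simp add: vec_eq_iff algebra_simps)
      then show False using that by simp
    qed
  qed
qed

end

section \<open>Direct products with the complex numbers\<close>

lemma append_coord_nth [simp]: "append_coord x r $ Some j = x $ j" "append_coord x r $ None = r"
  by (simp_all add: append_coord_def)

lemma drop_coord_nth [simp]: "drop_coord u $ j = u $ Some j"
  by (simp add: drop_coord_def)

lemma vec_option_eq_iff:
  fixes u v :: "complex^('n::finite option)"
  shows "u = v \<longleftrightarrow> drop_coord u = drop_coord v \<and> last_coord u = last_coord v"
  by (auto simp: vec_eq_iff last_coord_def split_option_all)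

lemma coord_simps [simp]:
  "drop_coord (append_coord x r) = x" "last_coord (append_coord x r) = r"
  "drop_coord (u + v) = drop_coord u + drop_coord v" "last_coord (u + v) = last_coord u + last_coord v"
  "drop_coord (u - v) = drop_coord u - drop_coord v" "last_coord (u - v) = last_coord u - last_coord v"
  "drop_coord (- u) = - drop_coord u" "last_coord (- u) = - last_coord u"
  "drop_coord (c *s u) = c *s drop_coord u" "last_coord (c *s u) = c * last_coord u"
  "drop_coord 0 = 0" "last_coord 0 = 0"
  by (simp_all add: vec_eq_iff last_coord_def)

text \<open>A basis of \<open>V\<close>, embedded with last coordinate 0, is completed by the last
  unit vector.\<close>

lemma dim_times_C:
  fixes V :: "(complex^'n::finite) set"
  assumes "vec.subspace V"
  shows "vec.dim {u. drop_coord u \<in> V} = vec.dim V + 1"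
proof -
  obtain B where B: "B \<subseteq> V" "vec.independent B" "V \<subseteq> vec.span B" "card B = vec.dim V"
    by (rule vec.basis_exists[of V]) 
  have finB: "finite B" using B(2) by (rule vec.finiteI_independent)
  define f :: "complex^'n \<Rightarrow> complex^('n option)" where "f = (\<lambda>v. append_coord v 0)"
  define b :: "complex^('n option)" where "b = append_coord 0 1"
  have lin: "Vector_Spaces.linear (*s) (*s) f"
    by unfold_locales (simp_all add: f_def vec_option_eq_iff)
  interpret f: Vector_Spaces.linear "(*s)" "(*s)" f by (rule lin)
  have "inj f" unfolding f_def inj_def by (metis coord_simps(1))
  have "vec.subspace {u :: complex^('n option). last_coord u = 0}"
    by (rule vec.subspaceI) auto
  then have "vec.span (f ` B) \<subseteq> {u. last_coord u = 0}"
    by (intro vec.span_minimal) (auto simp: f_def)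
  then have b: "b \<notin> vec.span (f ` B)" by (auto simp: b_def)
  have "vec.independent (f ` B)"
    using f.independent_inj_image[OF B(2)] \<open>inj f\<close> by blast
  then have indep: "vec.independent (insert b (f ` B))"
    using b vec.independent_insertI by blast
  show ?thesis
  proof (rule vec.dim_unique[OF _ _ indep])
    show "insert b (f ` B) \<subseteq> {u. drop_coord u \<in> V}"
      using B(1) assms by (auto simp: b_def f_def vec.subspace_0)
    show "{u. drop_coord u \<in> V} \<subseteq> vec.span (insert b (f ` B))"
    proof
      fix u :: "complex^('n option)" assume "u \<in> {u. drop_coord u \<in> V}"
      then have "drop_coord u \<in> vec.span B" using B(3) by auto
      then have "f (drop_coord u) \<in> vec.span (f ` B)" unfolding f.span_image by blast
      then have "f (drop_coord u) \<in> vec.span (insert b (f ` B))"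
        by (meson vec.span_mono subset_insertI subsetD)
      then have "f (drop_coord u) + last_coord u *s b \<in> vec.span (insert b (f ` B))"
        by (simp add: vec.span_add vec.span_scale vec.span_base)
      moreover have "f (drop_coord u) + last_coord u *s b = u"
        by (simp add: f_def b_def vec_option_eq_iff)
      ultimately show "u \<in> vec.span (insert b (f ` B))" by simp
    qed
    have "card (f ` B) = card B" using \<open>inj f\<close> by (metis card_image inj_on_subset subset_UNIV)
    moreover have "b \<notin> f ` B" using b vec.span_base by blast
    ultimately show "card (insert b (f ` B)) = vec.dim V + 1"
      using finB B(4) by simp
  qed
qed

lemma is_form_drop_coord: "is_form d p \<Longrightarrow> is_form d (\<lambda>u. p (drop_coord u))"
proof -
  assume "is_form d p"
  moreover have "form_tuple 1 drop_coord"
    unfolding form_tuple_def drop_coord_nth by (intro allI is_form_coord)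
  ultimately show ?thesis using is_form_compose[of d p 1 drop_coord] by simp
qed

lemma is_form_last_coord: "is_form 1 last_coord"
  unfolding last_coord_def by (rule is_form_coord)

lemma algebra_power_times_C:
  "algebra_power (times_C_mult m) (times_C_unit e) u k =
     append_coord (algebra_power m e (drop_coord u) k) (last_coord u ^ k)"
  by (induction k) (simp_all add: times_C_unit_def times_C_mult_def)

section \<open>Rank, minimal equation and adjoint of the product algebra\<close>

context adjoint_map
begin

text \<open>\<open>sq x\<close> and \<open>Q x\<close> differ by a combination of \<open>e\<close>
  and \<open>x\<close>, so \<open>e\<close>, \<open>x\<close>, \<open>sq x\<close> are independent
  as well.\<close>

lemma dim_generated:
  assumes "\<And>a b. Q x \<noteq> a *s e + b *s x"
  shows "vec.dim (generated_subalgebra mul e x) = 3"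
proof -
  have sq: "sq x \<noteq> a *s e + b *s x" for a b
  proof
    assume "sq x = a *s e + b *s x"
    then have "Q x = (a + S x) *s e + (b - \<tau> x) *s x"
      unfolding sq_eq by (simp add: vec_eq_iff algebra_simps)
    then show False using assms by blast
  qed
  have x: "x \<noteq> c *s e" for c
  proof
    assume "x = c *s e"
    then have "Q x = c\<^sup>2 *s e + 0 *s x" by (simp add: Q.scale Q_e)
    then show False using assms by blast
  qed
  have "x \<notin> vec.span {e}" using x by (auto simp: vec.span_singleton)
  then have 2: "vec.independent {x, e}"
    using e_nonzero by (intro vec.independent_insertI vec.independent_empty) simp_all
  have "sq x \<notin> vec.span {x, e}"
  proof
    assume "sq x \<in> vec.span {x, e}"
    then obtain b a where "sq x - b *s x = a *s e"
      by (auto simp: vec.span_insert vec.span_singleton)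
    then have "sq x = a *s e + b *s x" by (simp add: diff_eq_eq)
    then show False using sq by blast
  qed
  then have "vec.independent {sq x, x, e}" using 2 by (rule vec.independent_insertI)
  then show ?thesis
  proof (rule vec.dim_unique[rotated 2])
    show "{sq x, x, e} \<subseteq> generated_subalgebra mul e x"
      unfolding generated_eq using comb3_basis[of x, symmetric] by blast
    show "generated_subalgebra mul e x \<subseteq> vec.span {sq x, x, e}"
      unfolding generated_eq comb3_def
      by (auto intro!: vec.span_add vec.span_scale intro: vec.span_base)
    show "card {sq x, x, e} = 3"
      using x[of 1] sq[of 0 1] sq[of 1 0] by simp
  qed
qed

definition char_poly :: "complex^'n \<Rightarrow> complex \<Rightarrow> complex" where
  "char_poly x s = s^3 - \<tau> x * s\<^sup>2 + S x * s - N x"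

lemma subspace_generated: "vec.subspace (generated_subalgebra mul e x)"
proof -
  have "unital_subalgebra mul e (generated_subalgebra mul e x)"
    unfolding generated_subalgebra_def
    by (rule hull_in) (auto simp: unital_subalgebra_def vec.subspace_Inter)
  then show ?thesis unfolding unital_subalgebra_def by blast
qed

text \<open>Evaluating the cubic of \<open>x\<close> at \<open>(x, s)\<close> kills the first
  component and leaves \<open>char_poly x s\<close> in the last. If that is nonzero,
  \<open>(x, s)\<close> generates the idempotent \<open>(0, 1)\<close>, and the two factors
  separate.\<close>

lemma generated_times_C:
  assumes "char_poly (drop_coord u) (last_coord u) \<noteq> 0"
  shows "generated_subalgebra (times_C_mult mul) (times_C_unit e) u =
    {v. drop_coord v \<in> generated_subalgebra mul e (drop_coord u)}" (is "_ = ?G")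
proof
  define x s where "x = drop_coord u" and "s = last_coord u"
  have G: "unital_subalgebra mul e (generated_subalgebra mul e x)"
    unfolding generated_subalgebra_def
    by (rule hull_in) (auto simp: unital_subalgebra_def vec.subspace_Inter)
  have "unital_subalgebra (times_C_mult mul) (times_C_unit e) ?G"
    using G unfolding unital_subalgebra_def x_def[symmetric]
    by (auto simp: times_C_mult_def times_C_unit_def vec.subspace_def)
  moreover have "x \<in> generated_subalgebra mul e x"
    unfolding generated_subalgebra_def by (simp add: hull_inc)
  ultimately show "generated_subalgebra (times_C_mult mul) (times_C_unit e) u \<subseteq> ?G"
    unfolding generated_subalgebra_def[of "times_C_mult mul"] by (intro hull_minimal) (auto simp: x_def)
  have "v \<in> T" if T: "unital_subalgebra (times_C_mult mul) (times_C_unit e) T" "u \<in> T"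
    and v: "v \<in> ?G" for v T
  proof -
    note sub = T(1)[unfolded unital_subalgebra_def]
    have sp: "vec.subspace T" using sub by blast
    define u0 u2 u3 where "u0 = append_coord e 1" and "u2 = append_coord (sq x) (s\<^sup>2)"
      and "u3 = append_coord (mul x (sq x)) (s^3)"
    have u: "u = append_coord x s" by (simp add: x_def s_def vec_option_eq_iff)
    have u0: "u0 \<in> T" using sub unfolding u0_def times_C_unit_def by blast
    have "u2 = times_C_mult mul u u"
      by (simp add: u2_def u times_C_mult_def power2_eq_square)
    then have u2: "u2 \<in> T" using sub T(2) by simp
    have "u3 = times_C_mult mul u u2"
      by (simp add: u3_def u2_def u times_C_mult_def power2_eq_square power3_eq_cube mult.assoc)
    then have u3: "u3 \<in> T" using sub T(2) u2 by simp
    define c where "c = char_poly x s"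
    have c: "c \<noteq> 0" using assms by (simp add: c_def x_def s_def)
    have "(1 / c) *s (u3 - \<tau> x *s u2 + S x *s u - N x *s u0) \<in> T"
      by (intro vec.subspace_scale vec.subspace_add vec.subspace_diff sp u0 u2 u3 T(2))
    moreover have "(1 / c) *s (u3 - \<tau> x *s u2 + S x *s u - N x *s u0) = append_coord 0 1"
    proof -
      have "u3 - \<tau> x *s u2 + S x *s u - N x *s u0 = append_coord 0 c"
        unfolding u3_def u2_def u0_def u c_def char_poly_def vec_option_eq_iff
        by (simp add: mul_sq algebra_simps)
      then show ?thesis using c by (simp only:) (simp add: vec_option_eq_iff)
    qed
    ultimately have one: "append_coord 0 1 \<in> T" by simp
    obtain a b d where abd: "drop_coord v = comb3 x a b d"
      using v unfolding x_def[symmetric] generated_eq by blast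
    \<comment> \<open>The multiple of \<open>(0, 1)\<close> corrects the last coordinate.\<close>
    have "v = a *s u0 + b *s u + d *s u2 + (last_coord v - a - b * s - d * s\<^sup>2) *s append_coord 0 1"
      unfolding vec_option_eq_iff abd comb3_def u0_def u2_def by (simp add: u)
    also have "\<dots> \<in> T" by (intro vec.subspace_scale vec.subspace_add sp u0 u2 T(2) one)
    finally show ?thesis .
  qed
  then show "?G \<subseteq> generated_subalgebra (times_C_mult mul) (times_C_unit e) u"
    unfolding generated_subalgebra_def[of "times_C_mult mul"] hull_def by blast
qed

text \<open>A general element of the product has a general first component and a last one that is no
  root of its cubic; the rank is then 3 + 1.\<close>

lemma algebra_ranks:
  assumes "is_form 2 S" "is_form 3 N"
    and p: "is_polynomial p" "p w \<noteq> 0" "\<And>x a b. p x \<noteq> 0 \<Longrightarrow> Q x \<noteq> a *s e + b *s x"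
  shows "algebra_rank mul e 3" "algebra_rank (times_C_mult mul) (times_C_unit e) 4"
proof -
  show "algebra_rank mul e 3"
    unfolding algebra_rank_def using p dim_generated by blast
  define P where "P = (\<lambda>u. p (drop_coord u) * char_poly (drop_coord u) (last_coord u))"
  have drop: "is_polynomial (\<lambda>u. q (drop_coord u))" if "is_polynomial q" for q :: "complex^'n \<Rightarrow> complex"
    using that by (rule is_polynomial_compose) (simp add: is_polynomial_coord)
  have "is_polynomial \<tau>"
    by (rule is_form_imp_polynomial[OF is_form_linear]) (simp_all add: \<tau>_add \<tau>_scale)
  then have "is_polynomial P"
    unfolding P_def char_poly_def
    by (intro is_polynomial_mult is_polynomial_minus is_polynomial_add is_polynomial_power drop p
        is_form_imp_polynomial[OF is_form_last_coord] is_form_imp_polynomial[OF assms(1)]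
        is_form_imp_polynomial[OF assms(2)])
  moreover have "\<exists>u. P u \<noteq> 0"
  proof -
    \<comment> \<open>The cubic is monic, so some \<open>s\<close> is not a root of it.\<close>
    have "[:- N w, S w, - \<tau> w, 1:] \<noteq> 0" by simp
    then obtain s where "poly [:- N w, S w, - \<tau> w, 1:] s \<noteq> 0" using poly_all_0_iff_0 by blast
    then have "char_poly w s \<noteq> 0"
      by (simp add: char_poly_def algebra_simps power2_eq_square power3_eq_cube)
    then have "P (append_coord w s) \<noteq> 0" using p(2) by (simp add: P_def)
    then show ?thesis by blast
  qed
  moreover have "vec.dim (generated_subalgebra (times_C_mult mul) (times_C_unit e) u) = 4"
    if "P u \<noteq> 0" for u
  proof -
    have "vec.dim (generated_subalgebra mul e (drop_coord u)) = 3"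
      using that p(3) by (intro dim_generated) (auto simp: P_def)
    then show ?thesis
      using that generated_times_C[of u] dim_times_C[OF subspace_generated] by (simp add: P_def)
  qed
  ultimately show "algebra_rank (times_C_mult mul) (times_C_unit e) 4"
    unfolding algebra_rank_def by blast
qed

text \<open>The coefficients of \<open>(X - s) (X\<^sup>3 - \<tau> X\<^sup>2 + S X - N)\<close> at \<open>(x, s)\<close>, up to sign.\<close>

definition \<sigma> :: "nat \<Rightarrow> complex^('n option) \<Rightarrow> complex" where
  "\<sigma> i u = (let x = drop_coord u; s = last_coord u in
     if i = 0 then 1 else if i = 1 then \<tau> x + s else if i = 2 then S x + \<tau> x * s
     else if i = 3 then N x + S x * s else N x * s)"

lemma algebra_power_simps:
  "algebra_power mul e x 0 = e" "algebra_power mul e x (Suc 0) = x" "algebra_power mul e x 2 = sq x"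
  "algebra_power mul e x 3 = mul x (sq x)" "algebra_power mul e x 4 = mul x (mul x (sq x))"
  by (simp_all add: eval_nat_numeral mul_e_right)

text \<open>The factor with coefficients \<open>\<tau>\<close>, \<open>S\<close>, \<open>N\<close>
  vanishes at the first component by \<open>mul_sq\<close>, and the factor X - s at the
  last.\<close>

lemma generic_minimal_equation_times_C:
  assumes "is_form 2 S" "is_form 3 N"
    and "algebra_rank (times_C_mult mul) (times_C_unit e) 4"
  shows "generic_minimal_equation (times_C_mult mul) (times_C_unit e) 4 \<sigma>"
proof -
  have \<tau>: "is_form 1 \<tau>" by (rule is_form_linear) (simp_all add: \<tau>_add \<tau>_scale)
  note [simp] = is_form_drop_coord[OF \<tau>] is_form_drop_coord[OF \<tau>, unfolded One_nat_def] is_form_drop_coord[OF assms(1)] is_form_drop_coord[OF assms(2)]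
  have s: "is_form (Suc d) (\<lambda>u. p u * last_coord u)" if "is_form d p"
    for d and p :: "complex^('n option) \<Rightarrow> complex"
    using is_form_mult[OF that is_form_last_coord] by simp
  have "is_form i (\<sigma> i)" if "i \<le> 4" for i
  proof -
    have "\<sigma> 0 = (\<lambda>u. 1)" "\<sigma> 1 = (\<lambda>u. \<tau> (drop_coord u) + last_coord u)"
      "\<sigma> 2 = (\<lambda>u. S (drop_coord u) + \<tau> (drop_coord u) * last_coord u)"
      "\<sigma> 3 = (\<lambda>u. N (drop_coord u) + S (drop_coord u) * last_coord u)"
      "\<sigma> 4 = (\<lambda>u. N (drop_coord u) * last_coord u)"
      by (simp_all add: fun_eq_iff \<sigma>_def Let_def)
    moreover have "is_form 0 (\<lambda>u. 1 :: complex)" by (rule is_form_const)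
    moreover have "is_form 1 (\<lambda>u. \<tau> (drop_coord u) + last_coord u)"
      by (intro is_form_add is_form_last_coord) simp
    moreover have "is_form 2 (\<lambda>u. S (drop_coord u) + \<tau> (drop_coord u) * last_coord u)"
      using s[of 1 "\<lambda>u. \<tau> (drop_coord u)", unfolded Suc_1] by (intro is_form_add) simp_all
    moreover have "is_form 3 (\<lambda>u. N (drop_coord u) + S (drop_coord u) * last_coord u)"
      using s[of 2 "\<lambda>u. S (drop_coord u)"] by (intro is_form_add) simp_all
    moreover have "is_form 4 (\<lambda>u. N (drop_coord u) * last_coord u)"
      using s[of 3 "\<lambda>u. N (drop_coord u)"] by simp
    moreover have "i = 0 \<or> i = 1 \<or> i = 2 \<or> i = 3 \<or> i = 4" using that by auto
    ultimately show ?thesis by metis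
  qed
  moreover have "(\<Sum>i\<le>4. ((-1) ^ i * \<sigma> i u) *s
      algebra_power (times_C_mult mul) (times_C_unit e) u (4 - i)) = 0" for u
  proof -
    have "{..4::nat} = {0, 1, 2, 3, 4}" by auto
    then show ?thesis
      unfolding algebra_power_times_C vec_option_eq_iff
      by (simp add: algebra_power_simps \<sigma>_def mul_sq mul_linear mul_e_right Let_def
          del: algebra_power.simps(2))
        (simp add: vec_eq_iff algebra_simps power2_eq_square power3_eq_cube power4_eq_xxxx)
  qed
  ultimately show ?thesis
    using assms(3) unfolding generic_minimal_equation_def by (simp add: \<sigma>_def)
qed

text \<open>Reducing the cube by \<open>mul_sq\<close> leaves \<open>s\<close> times x^2 - T(x) x +
  S(x) e, which is \<open>Q x\<close>; in the last component everything but \<open>N x\<close>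
  cancels.\<close>

lemma algebra_adjoint_times_C:
  "algebra_adjoint (times_C_mult mul) (times_C_unit e) 4 \<sigma> u =
     append_coord (last_coord u *s Q (drop_coord u)) (N (drop_coord u))"
proof -
  have "{..<4::nat} = {0, 1, 2, 3}" by auto
  moreover have "Q x = sq x - \<tau> x *s x + S x *s e" for x unfolding sq_eq by simp
  ultimately show ?thesis
    unfolding algebra_adjoint_def algebra_power_times_C vec_option_eq_iff
    by (simp add: algebra_power_simps \<sigma>_def mul_sq mul_e_right Let_def
        del: algebra_power.simps(2))
      (simp add: vec_eq_iff algebra_simps power2_eq_square power3_eq_cube)
qed

end

section \<open>Quadro-quadric Cremona transformations\<close>

text \<open>By the minors \<open>P x $ i\<close> vanishes with \<open>x $ i\<close>, hence is
  divisible by it, and the quotients agree. Applied to the composite of \<open>F\<close> after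
  \<open>G\<close>, this produces the cubic of the inverse.\<close>

lemma form_tuple_proportional_to_id:
  fixes P :: "complex^'n::finite \<Rightarrow> complex^'n"
  assumes P: "form_tuple (Suc d) P" and minors: "\<And>x i j. P x $ i * x $ j = P x $ j * x $ i"
  obtains M where "is_form d M" "\<And>x. P x = M x *s x"
proof -
  have Pform: "is_form (Suc d) (\<lambda>x. P x $ i)" for i using P by (simp add: form_tuple_def)
  have zero: "P x $ i = 0" if "x $ i = 0" for x i
  proof (cases "x = 0")
    case True
    then show ?thesis using is_form_homogeneous[OF Pform, of 0 x i] by simp
  next
    case False
    then obtain j where "x $ j \<noteq> 0" by (auto simp: vec_eq_iff)
    then show ?thesis using minors[of x i j] that by simp
  qed
  have "\<forall>i. \<exists>q. is_form d q \<and> (\<forall>x. P x $ i = x $ i * q x)"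
  proof
    fix i
    show "\<exists>q. is_form d q \<and> (\<forall>x. P x $ i = x $ i * q x)"
      by (rule is_form_dvd_coord[OF Pform[of i] zero[where i = i]]) blast+
  qed
  from choice[OF this] obtain q where
    q: "\<And>i. is_form d (q i)" "\<And>i x. P x $ i = x $ i * q i x" by blast
  \<comment> \<open>The minors give equality off the zeros of \<open>x $ i * x $ j\<close>; the
    all-ones vector shows that this product is not the zero polynomial.\<close>
  have eq: "q i x = q j x" for i j x
  proof (rule is_polynomial_eqI[of "q i" "q j" "\<lambda>x. x $ i * x $ j" "\<chi> i. 1"])
    show "is_polynomial (q i)" "is_polynomial (q j)" using q(1) by (rule is_form_imp_polynomial)+
    show "is_polynomial (\<lambda>x. x $ i * x $ j)" by (intro is_polynomial_mult is_polynomial_coord)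
    show "q i x = q j x" if "x $ i * x $ j \<noteq> 0" for x
    proof -
      have "(x $ i * x $ j) * q i x = (x $ i * x $ j) * q j x"
        using minors[of x i j] unfolding q(2) by (simp add: mult_ac)
      then show ?thesis using that by simp
    qed
  qed simp
  \<comment> \<open>Since all quotients agree, any fixed index serves.\<close>
  have "P x $ i = (q undefined x *s x) $ i" for x i
    using q(2)[of x i] eq[of i x undefined] by simp
  then have "P x = q undefined x *s x" for x by (simp add: vec_eq_iff)
  then show thesis by (rule that[OF q(1)])
qed

lemma is_form_normalize_value:
  assumes "is_form 3 N" "N x \<noteq> 0"
  obtains e where "N e = 1"
proof -
  \<comment> \<open>A cube root of \<open>1 / N x\<close>, by which \<open>x\<close> is
    rescaled.\<close>
  define c where "c = exp (Ln (1 / N x) / 3)"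
  have "c ^ 3 = 1 / N x"
    unfolding c_def exp_of_nat_mult[symmetric] using assms(2) by (simp add: exp_of_nat_mult[symmetric])
  then have "N (c *s x) = 1" using is_form_homogeneous[OF assms(1)] assms(2) by simp
  then show thesis by (rule that)
qed

section \<open>Normalizing a quadro-quadric transformation at a point\<close>

locale quadro_quadric =
  F: quadratic_map F + G: quadratic_map G
  for F G :: "complex^'n::finite \<Rightarrow> complex^'n" +
  fixes e :: "complex^'n" and N \<tau> S M \<tau>' S' :: "complex^'n \<Rightarrow> complex"
  assumes e_nonzero: "e \<noteq> 0"
    and GF: "G (F x) = N x *s x"
    and FG: "F (G y) = M y *s y"
    and \<tau>_add: "\<tau> (x + y) = \<tau> x + \<tau> y"
    and \<tau>_scale: "\<tau> (c *s x) = c * \<tau> x"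
    and \<tau>'_add: "\<tau>' (x + y) = \<tau>' x + \<tau>' y"
    and \<tau>'_scale: "\<tau>' (c *s x) = c * \<tau>' x"
    and N_expand: "N (s *s e + t *s w) = s^3 + s\<^sup>2 * t * \<tau> w + s * t\<^sup>2 * S w + t^3 * N w"
    and M_expand: "M (s *s F e + t *s w) = s^3 + s\<^sup>2 * t * \<tau>' w + s * t\<^sup>2 * S' w + t^3 * M w"
begin

lemma N_e: "N e = 1"
  using N_expand[of 1 0] by simp

lemma G_F_e: "G (F e) = e"
  using GF[of e] by (simp add: N_e)

lemma F_e_nonzero: "F e \<noteq> 0"
proof
  assume "F e = 0"
  then show False using G_F_e G.zero e_nonzero by simp
qed

text \<open>The assumptions are symmetric because \<open>G (F e) = e\<close>, so each identity
  transfers to the exchanged pair.\<close>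

lemma dual: "quadro_quadric G F (F e) M \<tau>' S' N \<tau> S"
  by unfold_locales
    (simp_all add: F_e_nonzero GF FG N_e \<tau>_add \<tau>_scale \<tau>'_add \<tau>'_scale G_F_e M_expand N_expand)

text \<open>The coefficient of \<open>t\<close> in \<open>G (F (e + t v)) = N (e + t v) (e + t v)\<close>.\<close>

lemma polar_G_polar_F: "polar G (F e) (polar F e v) = v + \<tau> v *s e"
proof -
  have Ft: "F (e + t *s v) = F e + t *s polar F e v + t\<^sup>2 *s F v" for t
    by (simp add: F.expand)
  have Nt: "N (e + t *s v) = 1 + t * \<tau> v + t\<^sup>2 * S v + t^3 * N v" for t
    using N_expand[of 1 t v] by simp
  have "0 + t *s (polar G (F e) (polar F e v) - (v + \<tau> v *s e))
      + t\<^sup>2 *s (G (polar F e v) + polar G (F e) (F v) - (\<tau> v *s v + S v *s e))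
      + t^3 *s (polar G (polar F e v) (F v) - (S v *s v + N v *s e))
      + t^4 *s 0 = 0" for t
  proof -
    have "G (F e) + t *s polar G (F e) (polar F e v)
        + t\<^sup>2 *s (G (polar F e v) + polar G (F e) (F v))
        + t^3 *s polar G (polar F e v) (F v) + t^4 *s G (F v) = N (e + t *s v) *s (e + t *s v)"
      using GF[of "e + t *s v"] unfolding Ft G.curve .
    then show ?thesis
      unfolding Nt GF N_e
      by (simp add: vec_eq_iff) (simp add: algebra_simps power2_eq_square power3_eq_cube power4_eq_xxxx)
  qed
  from vec_polynomial_coeffs_eq_0(1)[OF this] show ?thesis by simp
qed

lemma polar_F_polar_G: "polar F e (polar G (F e) w) = w + \<tau>' w *s F e"
  using quadro_quadric.polar_G_polar_F[OF dual, of w] unfolding G_F_e .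

text \<open>\<open>polar_G_polar_F\<close> is applied at \<open>polar G (F e) w\<close>, whose inner
  polarization is evaluated by the dual identity.\<close>

lemma \<tau>_polar: "\<tau> (polar G (F e) w) = 2 * \<tau>' w"
proof -
  have "polar G (F e) (polar F e (polar G (F e) w)) = polar G (F e) w + (2 * \<tau>' w) *s e"
    unfolding polar_F_polar_G by (simp add: G.polar_add G.polar_scale G.polar_self G_F_e mult.commute)
  then have "\<tau> (polar G (F e) w) *s e = (2 * \<tau>' w) *s e"
    unfolding polar_G_polar_F by simp
  then show ?thesis using e_nonzero by (simp only: vec.scale_cancel_right) simp
qed

lemma \<tau>_e: "\<tau> e = 3"
proof -
  have "(4 :: complex) *s e = e + \<tau> e *s e"
    using polar_G_polar_F[of e] by (simp add: F.polar_self G.polar_scale G.polar_self G_F_e)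
  then have "(\<tau> e - 3) *s e = 0" by (simp add: vec_eq_iff algebra_simps)
  then show ?thesis using e_nonzero by simp
qed

text \<open>These maps are inverse to each other, and composing \<open>F\<close> and
  \<open>G\<close> with them gives both composites the polarization \<open>\<tau> v *s e - v\<close>
  at \<open>e\<close>.\<close>

definition \<phi> :: "complex^'n \<Rightarrow> complex^'n" where "\<phi> v = \<tau> v *s F e - polar F e v"
definition \<psi> :: "complex^'n \<Rightarrow> complex^'n" where "\<psi> w = \<tau>' w *s e - polar G (F e) w"

lemma \<phi>_linear: "Vector_Spaces.linear (*s) (*s) \<phi>"
  by unfold_locales
    (simp_all add: \<phi>_def \<tau>_add \<tau>_scale F.polar_add F.polar_scale vec_eq_iff algebra_simps)

lemma \<psi>_linear: "Vector_Spaces.linear (*s) (*s) \<psi>"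
  by unfold_locales
    (simp_all add: \<psi>_def \<tau>'_add \<tau>'_scale G.polar_add G.polar_scale vec_eq_iff algebra_simps)

lemma \<tau>_\<psi>: "\<tau> (\<psi> w) = \<tau>' w"
proof -
  have "\<tau> (\<tau>' w *s e) = \<tau> (\<psi> w) + \<tau> (polar G (F e) w)"
    unfolding \<psi>_def \<tau>_add[symmetric] by simp
  then show ?thesis unfolding \<tau>_polar \<tau>_scale \<tau>_e by simp
qed

text \<open>The multiples of \<open>F e\<close> occur with factors 1, -2 and 1 and cancel.\<close>

lemma \<phi>_\<psi>: "\<phi> (\<psi> w) = w"
  unfolding \<phi>_def \<tau>_\<psi>
  unfolding \<psi>_def F.polar_diff F.polar_scale F.polar_self polar_F_polar_G
  by (simp add: vec_eq_iff algebra_simps)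

lemma dual_\<phi>: "quadro_quadric.\<phi> G (F e) \<tau>' = \<psi>"
  unfolding quadro_quadric.\<phi>_def[OF dual] \<psi>_def G_F_e by (rule refl)

lemma dual_\<psi>: "quadro_quadric.\<psi> G F (F e) \<tau> = \<phi>"
  unfolding quadro_quadric.\<psi>_def[OF dual] \<phi>_def G_F_e by (rule refl)

lemma \<psi>_\<phi>: "\<psi> (\<phi> v) = v"
  using quadro_quadric.\<phi>_\<psi>[OF dual, of v] unfolding dual_\<phi> dual_\<psi> .

lemma \<tau>'_\<phi>: "\<tau>' (\<phi> v) = \<tau> v"
  using quadro_quadric.\<tau>_\<psi>[OF dual, of v] unfolding dual_\<psi> .

lemma \<phi>_e: "\<phi> e = F e"
  by (simp add: \<phi>_def \<tau>_e F.polar_self vec_eq_iff)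

lemma \<psi>_F_e: "\<psi> (F e) = e"
  using \<psi>_\<phi>[of e] by (simp add: \<phi>_e)

sublocale \<phi>: Vector_Spaces.linear "(*s)" "(*s)" \<phi> by (rule \<phi>_linear)
sublocale \<psi>: Vector_Spaces.linear "(*s)" "(*s)" \<psi> by (rule \<psi>_linear)

abbreviation Q :: "complex^'n \<Rightarrow> complex^'n" where "Q \<equiv> \<lambda>x. \<psi> (F x)"
abbreviation R :: "complex^'n \<Rightarrow> complex^'n" where "R \<equiv> \<lambda>x. G (\<phi> x)"

lemma normalized_pair: "normalized_pair Q R e N (\<lambda>x. M (\<phi> x)) \<tau> S (\<lambda>x. S' (\<phi> x))"
proof -
  interpret Q: quadratic_map Q
    by (rule quadratic_map_compose_linear[OF F.quadratic_map_axioms \<psi>_linear])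
  interpret R: quadratic_map R
    by (rule quadratic_map_precompose_linear[OF G.quadratic_map_axioms \<phi>_linear])
  show ?thesis
  proof unfold_locales
    show "polar Q e v = \<tau> v *s e - v" for v
    proof -
      have "polar Q e v = \<psi> (polar F e v)" by (simp add: polar_def \<psi>.diff)
      also have "polar F e v = \<tau> v *s F e - \<phi> v" by (simp add: \<phi>_def)
      finally show ?thesis by (simp add: \<psi>.diff \<psi>.scale \<psi>_F_e \<psi>_\<phi>)
    qed
    show "polar R e v = \<tau> v *s e - v" for v
    proof -
      have "polar R e v = polar G (F e) (\<phi> v)" by (simp add: polar_def \<phi>.add \<phi>_e)
      also have "\<dots> = \<tau>' (\<phi> v) *s e - \<psi> (\<phi> v)" by (simp add: \<psi>_def)
      finally show ?thesis by (simp add: \<tau>'_\<phi> \<psi>_\<phi>)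
    qed
    show "M (\<phi> (s *s e + t *s w)) =
        s^3 + s\<^sup>2 * t * \<tau> w + s * t\<^sup>2 * S' (\<phi> w) + t^3 * M (\<phi> w)" for s t w
      by (simp add: \<phi>.add \<phi>.scale \<phi>_e M_expand \<tau>'_\<phi>)
  qed (simp_all add: e_nonzero \<tau>_add \<tau>_scale \<phi>_\<psi> GF FG \<psi>.scale \<psi>_\<phi> \<psi>_F_e \<phi>_e N_e N_expand)
qed

text \<open>Otherwise the linear form \<open>l\<close> of \<open>collinear_imp_linear_factor\<close>
  divides \<open>Q\<close> and, after applying \<open>\<phi>\<close>, also \<open>F\<close>. It is
  not constant, as \<open>l e = -1\<close> while \<open>l\<close> vanishes at 0.\<close>

lemma exists_noncollinear:
  assumes "no_common_factor F"
  shows "\<exists>w. \<forall>a b. Q w \<noteq> a *s e + b *s w"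
proof (rule ccontr)
  interpret normalized_pair Q R e N "\<lambda>x. M (\<phi> x)" \<tau> S "\<lambda>x. S' (\<phi> x)"
    by (rule normalized_pair)
  assume "\<not> ?thesis"
  then have "\<exists>a b. Q v = a *s e + b *s v" for v by blast
  then obtain l where l: "\<And>x y. l (x + y) = l x + l y" "\<And>c x. l (c *s x) = c * l x" "l e = -1"
    and Ql: "\<And>v. Q v = l v *s (v - (l v + \<tau> v) *s e)"
    by (rule collinear_imp_linear_factor) blast
  have lin: "is_polynomial f" if "\<And>x y. f (x + y) = f x + f y" "\<And>c x. f (c *s x) = c * f x"
    for f :: "complex^'n \<Rightarrow> complex"
    using is_form_linear[OF that] by (rule is_form_imp_polynomial)
  have "\<exists>q. is_polynomial q \<and> (\<forall>x. F x $ i = l x * q x)" for i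
  proof (intro exI conjI allI)
    have "is_polynomial (\<lambda>v. \<phi> v $ i)" by (rule lin) (simp_all add: \<phi>.add \<phi>.scale)
    moreover have "is_polynomial l" "is_polynomial \<tau>"
      by (intro lin l(1,2) \<tau>_add \<tau>_scale)+
    ultimately show "is_polynomial (\<lambda>v. \<phi> v $ i - (l v + \<tau> v) * F e $ i)"
      by (intro is_polynomial_minus is_polynomial_mult is_polynomial_add is_polynomial_const)
    fix v
    have "F v = l v *s (\<phi> v - (l v + \<tau> v) *s F e)"
      using arg_cong[OF Ql[of v], of \<phi>] unfolding \<phi>_\<psi> \<phi>.scale \<phi>.diff \<phi>_e .
    from arg_cong[OF this, of "\<lambda>x. x $ i"]
    show "F v $ i = l v * (\<phi> v $ i - (l v + \<tau> v) * F e $ i)"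
      unfolding vector_smult_component vector_minus_component .
  qed
  then have "is_polynomial l \<and> (\<forall>i. \<exists>q. is_polynomial q \<and> (\<forall>x. F x $ i = l x * q x))"
    using lin[OF l(1,2)] by (intro conjI allI)
  from assms[unfolded no_common_factor_def, rule_format, OF this]
  obtain c where "\<And>x. l x = c" by blast
  then show False using l(3) l(2)[of 0 e] by simp
qed

lemma adjoint_map_Q:
  assumes F: "form_tuple 2 F" and G: "form_tuple 2 G" and ncf: "no_common_factor F"
  obtains p w where "adjoint_map Q e N \<tau> S" "is_polynomial p" "p w \<noteq> 0"
    "\<And>x a b. p x \<noteq> 0 \<Longrightarrow> Q x \<noteq> a *s e + b *s x"
proof -
  interpret normalized_pair Q R e N "\<lambda>x. M (\<phi> x)" \<tau> S "\<lambda>x. S' (\<phi> x)"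
    by (rule normalized_pair)
  have "form_tuple 2 Q" "form_tuple 2 R"
    using form_tuple_compose[OF form_tuple_linear[OF \<psi>_linear] F]
      form_tuple_compose[OF G form_tuple_linear[OF \<phi>_linear]] by simp_all
  then have poly: "is_polynomial (\<lambda>x. Q x $ i)" "is_polynomial (\<lambda>x. R x $ i)" for i
    unfolding form_tuple_def by (blast intro: is_form_imp_polynomial)+
  obtain w where w: "\<And>a b. Q w \<noteq> a *s e + b *s w" using exists_noncollinear[OF ncf] by blast
  obtain p where p: "is_polynomial p" "p w \<noteq> 0"
    "\<And>x a b. p x \<noteq> 0 \<Longrightarrow> Q x \<noteq> a *s e + b *s x"
    by (rule generic_noncollinear[OF poly(1) w]) blast
  \<comment> \<open>Equality at general points suffices, since both sides are polynomials.\<close>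
  have "R x $ i = Q x $ i" for x i
    by (rule is_polynomial_eqI[OF poly(2) poly(1) p(1,2)]) (simp add: R_eq_Q_generic p(3))
  then have RQ_eq: "R x = Q x" for x by (simp add: vec_eq_iff)
  have QQ: "Q (Q x) = N x *s x" for x using RQ[of x] RQ_eq[of "Q x"] by simp
  have "normalized_pair Q Q e N N \<tau> S S"
    by unfold_locales (simp_all add: QQ Q_e polar_Q_e N_expand e_nonzero \<tau>_add \<tau>_scale)
  then show thesis using that p unfolding adjoint_map_def by blast
qed

end

section \<open>The extension to one more variable\<close>

definition extension ::
  "(complex^'n::finite \<Rightarrow> complex^'n) \<Rightarrow> (complex^'n \<Rightarrow> complex) \<Rightarrow>
     complex^('n option) \<Rightarrow> complex^('n option)" where
  "extension F N u = append_coord (last_coord u *s F (drop_coord u)) (N (drop_coord u))"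

lemma form_tuple_extension:
  assumes "form_tuple 2 F" "is_form 3 N"
  shows "form_tuple 3 (extension F N)"
  unfolding form_tuple_def
proof
  fix i
  show "is_form 3 (\<lambda>u. extension F N u $ i)"
  proof (cases i)
    case None
    then show ?thesis using is_form_drop_coord[OF assms(2)] by (simp add: extension_def)
  next
    case (Some j)
    have "is_form 2 (\<lambda>x. F x $ j)" using assms(1) by (simp add: form_tuple_def)
    from is_form_mult[OF is_form_last_coord is_form_drop_coord[OF this]]
    show ?thesis by (simp add: Some extension_def numeral_3_eq_3)
  qed
qed

text \<open>A common factor divides \<open>N\<close>, which is free of the last variable, so by
  degree the factor is free of it too. Setting that variable to 1 makes it a common factor of
  \<open>F\<close>.\<close>

lemma no_common_factor_extension:
  assumes F: "no_common_factor F" and N: "is_polynomial N" "N x0 \<noteq> 0"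
  shows "no_common_factor (extension F N)"
  unfolding no_common_factor_def
proof (intro allI impI, elim conjE)
  fix h assume h: "is_polynomial h"
    and dvd: "\<forall>i. \<exists>q. is_polynomial q \<and> (\<forall>u. extension F N u $ i = h u * q u)"
  from choice[OF dvd] obtain q where q: "\<And>i. is_polynomial (q i)"
    "\<And>i u. extension F N u $ i = h u * q i u" by blast
  have append: "is_polynomial (\<lambda>x. g (append_coord x r))" if "is_polynomial g" for g r
    using that
  proof (rule is_polynomial_compose)
    show "is_polynomial (\<lambda>x. append_coord x r $ i)" for i
      by (cases i) (simp_all add: is_polynomial_const is_polynomial_coord)
  qed
  have drop: "is_polynomial (\<lambda>u. g (drop_coord u))" if "is_polynomial g" for g
    using that by (rule is_polynomial_compose) (simp add: is_polynomial_coord)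
  define h0 where "h0 x = h (append_coord x 0)" for x
  have h0: "is_polynomial h0" unfolding h0_def by (rule append[OF h])
  have "h u = h0 (drop_coord u)" for u
  proof (rule is_polynomial_eqI[OF h drop[OF h0] drop[OF N(1)]])
    show "N (drop_coord (append_coord x0 0)) \<noteq> 0" using N(2) by simp
    fix u assume Nu: "N (drop_coord u) \<noteq> 0"
    \<comment> \<open>The line through \<open>u\<close> in the direction of the last axis;
      \<open>N\<close> is a nonzero constant along it, so its divisor \<open>h\<close> is constant
      there.\<close>
    define a b where "a = append_coord (drop_coord u) 0" and "b = append_coord (0 :: complex^'a) 1"
    have u: "u = a + last_coord u *s b" by (simp add: a_def b_def vec_option_eq_iff)
    obtain P where P: "\<And>t. h (a + t *s b) = poly P t"
      by (rule is_polynomial_on_line[OF h]) blast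
    obtain P' where P': "\<And>t. q None (a + t *s b) = poly P' t"
      by (rule is_polynomial_on_line[OF q(1)]) blast
    have "poly (P * P') t = poly [:N (drop_coord u):] t" for t
    proof -
      have "h (a + t *s b) * q None (a + t *s b) = N (drop_coord (a + t *s b))"
        using q(2)[of "a + t *s b" None] by (simp add: extension_def)
      moreover have "drop_coord (a + t *s b) = drop_coord u" by (simp add: a_def b_def)
      ultimately show ?thesis by (simp add: P P')
    qed
    then have "poly (P * P') = poly [:N (drop_coord u):]" by (rule ext)
    then have PP: "P * P' = [:N (drop_coord u):]" by (simp only: poly_eq_poly_eq_iff)
    then have "P * P' \<noteq> 0" using Nu by simp
    then have "P \<noteq> 0" "P' \<noteq> 0" by auto
    then have "degree P + degree P' = 0" using PP degree_mult_eq[of P P'] by simp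
    then obtain c where "P = [:c:]" by (metis add_is_0 degree_eq_zeroE)
    then have "h (a + last_coord u *s b) = h (a + 0 *s b)" unfolding P by simp
    then show "h u = h0 (drop_coord u)" using u by (simp add: h0_def a_def)
  qed
  moreover have "\<exists>c. \<forall>x. h0 x = c"
  proof -
    have "F x $ j = h0 x * q (Some j) (append_coord x 1)" for x j
      using q(2)[of "append_coord x 1" "Some j"] calculation[of "append_coord x 1"]
      by (simp add: extension_def)
    then have "\<exists>q. is_polynomial q \<and> (\<forall>x. F x $ j = h0 x * q x)" for j
      using append[OF q(1)] by (intro exI[of _ "\<lambda>x. q (Some j) (append_coord x 1)"] conjI allI)
    then have "is_polynomial h0 \<and> (\<forall>j. \<exists>q. is_polynomial q \<and> (\<forall>x. F x $ j = h0 x * q x))"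
      using h0 by (intro conjI allI)
    from F[unfolded no_common_factor_def, rule_format, OF this] show ?thesis by blast
  qed
  ultimately show "\<exists>c. \<forall>u. h u = c" by auto
qed

text \<open>At \<open>(x, r)\<close> the first component is \<open>N x *s G (r *s F x)\<close> and
  the last is \<open>M (r *s F x)\<close>; homogeneity and \<open>MF\<close> extract the same factor
  from both.\<close>

lemma extension_compose:
  assumes F: "quadratic_map F" and G: "quadratic_map G" and N: "is_form 3 N" and M: "is_form 3 M"
    and GF: "\<And>x. G (F x) = N x *s x" and FG: "\<And>y. F (G y) = M y *s y"
  shows "extension G M (extension F N u) = ((N (drop_coord u))\<^sup>2 * (last_coord u)\<^sup>2) *s u"
proof -
  interpret F: quadratic_map F by fact
  interpret G: quadratic_map G by fact
  define x r where "x = drop_coord u" and "r = last_coord u"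
  \<comment> \<open>\<open>F (G (F x))\<close> is computed in two ways, which needs
    \<open>F x\<close> to be nonzero for cancelling; where \<open>F x = 0\<close>, both sides
    vanish.\<close>
  have MF: "M (F x) = (N x)\<^sup>2"
  proof (cases "F x = 0")
    case True
    have "N 0 = 0" "M 0 = 0"
      using is_form_homogeneous[OF N, of 0 0] is_form_homogeneous[OF M, of 0 0] by simp_all
    moreover have "N x *s x = 0" using GF[of x] True G.zero by simp
    ultimately show ?thesis using True by auto
  next
    case False
    have "M (F x) *s F x = (N x)\<^sup>2 *s F x"
      using FG[of "F x", symmetric] unfolding GF F.scale .
    then show ?thesis using False unfolding vec.scale_cancel_right by blast
  qed
  show ?thesis
    unfolding vec_option_eq_iff extension_def x_def[symmetric] r_def[symmetric]
    by (simp add: x_def[symmetric] r_def[symmetric] G.scale GF is_form_homogeneous[OF M] MF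
        power2_eq_square power3_eq_cube mult_ac)
qed

lemma ratmap_extension:
  assumes "form_tuple 2 F" "is_form 3 N" "N x \<noteq> 0"
  shows "ratmap (extension F N)"
proof -
  have "last_coord (extension F N (append_coord x 0)) \<noteq> 0" using assms(3) by (simp add: extension_def)
  then have "extension F N (append_coord x 0) \<noteq> 0" by auto
  then show ?thesis using form_tuple_extension[OF assms(1,2)] unfolding ratmap_def by blast
qed

lemma ratmap_eq_extension_compose:
  assumes F: "form_tuple 2 F" and G: "form_tuple 2 G" and N: "is_form 3 N" and M: "is_form 3 M"
    and GF: "\<And>x. G (F x) = N x *s x" and FG: "\<And>y. F (G y) = M y *s y"
    and Nx: "N x \<noteq> 0"
  shows "ratmap_eq (extension G M \<circ> extension F N) (\<lambda>u. u)"
proof -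
  have eq: "(extension G M \<circ> extension F N) u = ((N (drop_coord u))\<^sup>2 * (last_coord u)\<^sup>2) *s u" for u
    using extension_compose[OF form_tuple_quadratic_map[OF F] form_tuple_quadratic_map[OF G] N M GF FG]
    by simp
  define u where "u = append_coord x 1"
  have "last_coord u \<noteq> 0" by (simp add: u_def)
  then have "u \<noteq> 0" by auto
  moreover have "(extension G M \<circ> extension F N) u \<noteq> 0"
    unfolding eq using \<open>u \<noteq> 0\<close> Nx by (simp add: u_def)
  moreover have "form_tuple (3 * 3) (extension G M \<circ> extension F N)"
    unfolding o_def by (intro form_tuple_compose form_tuple_extension assms)
  moreover have "form_tuple 1 (\<lambda>u :: complex^('a option). u)"
    unfolding form_tuple_def by (intro allI is_form_coord)
  ultimately show ?thesis
    unfolding ratmap_eq_def ratmap_def eq by (auto simp: mult_ac)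
qed

section \<open>Linear equivalence with the adjoint of the product algebra\<close>

lemma linearly_equivalent_by_iso:
  assumes f: "Vector_Spaces.linear (*s) (*s) (f :: complex^'n::finite \<Rightarrow> complex^'n)"
    and g: "Vector_Spaces.linear (*s) (*s) g"
    and fg: "\<And>x. f (g x) = x" "\<And>x. g (f x) = x"
    and H: "ratmap H" "\<And>x. H x = f (K x)"
  shows "linearly_equivalent K H"
proof -
  have "matrix f ** matrix g = mat 1" "matrix g ** matrix f = mat 1"
    unfolding matrix_eq
    by (simp_all only: matrix_vector_mul_assoc[symmetric] matrix_works[OF f] matrix_works[OF g] fg
        matrix_vector_mul_lid simp_thms)
  then have "invertible (matrix f)" unfolding invertible_def by blast
  moreover have "invertible (mat 1 :: complex^'n^'n)" unfolding invertible_def by (intro exI[of _ "mat 1"]) simp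
  moreover have "ratmap_eq H (\<lambda>x. matrix f *v K (mat 1 *v x))"
  proof -
    have "(\<lambda>x. matrix f *v K (mat 1 *v x)) = H"
      by (simp add: fun_eq_iff matrix_works f H(2))
    then show ?thesis using H(1) by (simp add: ratmap_eq_def mult.commute)
  qed
  ultimately show ?thesis unfolding linearly_equivalent_def by blast
qed

theorem proposition2p2:
  fixes F :: "complex^'n::finite \<Rightarrow> complex^'n" and N :: "complex^'n \<Rightarrow> complex"
  assumes "form_tuple 2 F"
    and "no_common_factor F"
    and "cremona_bidegree 2 2 F"
    and "secant_cubic F N"
  defines "H \<equiv> \<lambda>u :: complex^('n option).
      append_coord (last_coord u *s F (drop_coord u)) (N (drop_coord u))"
  shows "cremona_bidegree 3 3 H \<and> spampinato_type H"
proof -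
  have H: "H = extension F N" by (simp add: H_def extension_def fun_eq_iff)
  obtain G where N: "is_form 3 N" and G: "form_tuple 2 G" "no_common_factor G"
    and inv: "birational_inverse F G" and GF: "\<And>x. G (F x) = N x *s x"
    using assms(4) unfolding secant_cubic_def by blast
  \<comment> \<open>The composite has degree 4 and is proportional to the identity, so the factor
    \<open>M\<close> is a cubic form.\<close>
  have "form_tuple (Suc 3) (\<lambda>y. F (G y))" using form_tuple_compose[OF assms(1) G(1)] by simp
  moreover have "F (G y) $ i * y $ j = F (G y) $ j * y $ i" for y i j
    using inv unfolding birational_inverse_def ratmap_eq_def by simp
  ultimately obtain M where M: "is_form 3 M" and FG: "\<And>y. F (G y) = M y *s y"
    by (rule form_tuple_proportional_to_id) blast
  obtain x where "G (F x) \<noteq> 0"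
    using inv unfolding birational_inverse_def ratmap_eq_def ratmap_def by auto
  then have "N x \<noteq> 0" unfolding GF by auto
  then obtain e where e: "N e = 1" by (rule is_form_normalize_value[OF N])
  interpret F: quadratic_map F by (rule form_tuple_quadratic_map) fact
  interpret G: quadratic_map G by (rule form_tuple_quadratic_map) fact
  have e0: "e \<noteq> 0" using e is_form_homogeneous[OF N, of 0 0] by auto
  have GFe: "G (F e) = e" using GF[of e] e by simp
  then have "F e \<noteq> 0" using e0 G.zero by metis
  \<comment> \<open>\<open>F (G (F e))\<close> is computed in two ways, which normalizes
    \<open>M\<close> at \<open>F e\<close>.\<close>
  moreover have "M (F e) *s F e = 1 *s F e" using FG[of "F e"] GFe by simp
  ultimately have Me: "M (F e) = 1" by (simp only: vec.scale_cancel_right) simp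
  obtain \<tau> S where S: "is_form 2 S" "\<And>x y. \<tau> (x + y) = \<tau> x + \<tau> y" "\<And>c x. \<tau> (c *s x) = c * \<tau> x"
    and Nex: "\<And>s t w. N (s *s e + t *s w) = s^3 * N e + s\<^sup>2 * t * \<tau> w + s * t\<^sup>2 * S w + t^3 * N w"
    by (rule cubic_form_expand[OF N, of e]) blast
  obtain \<tau>' S' where S': "is_form 2 S'" "\<And>x y. \<tau>' (x + y) = \<tau>' x + \<tau>' y" "\<And>c x. \<tau>' (c *s x) = c * \<tau>' x"
    and Mex: "\<And>s t w. M (s *s F e + t *s w) = s^3 * M (F e) + s\<^sup>2 * t * \<tau>' w + s * t\<^sup>2 * S' w + t^3 * M w"
    by (rule cubic_form_expand[OF M, of "F e"]) blast
  interpret quadro_quadric F G e N \<tau> S M \<tau>' S'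
    by unfold_locales (simp_all add: e0 GF FG S S' Nex Mex e Me)
  obtain p w where adj: "adjoint_map Q e N \<tau> S" and p: "is_polynomial p" "p w \<noteq> 0"
    "\<And>x a b. p x \<noteq> 0 \<Longrightarrow> Q x \<noteq> a *s e + b *s x"
    by (rule adjoint_map_Q[OF assms(1) G(1) assms(2)]) blast
  interpret J: adjoint_map Q e N \<tau> S by (rule adj)
  have Ne: "N e \<noteq> 0" and MFe: "M (F e) \<noteq> 0" using e Me by simp_all
  have ratmap: "ratmap (extension F N)" "ratmap (extension G M)"
    using ratmap_extension[OF assms(1) N Ne] ratmap_extension[OF G(1) M MFe] by blast+
  \<comment> \<open>The inverse is the extension of \<open>G\<close> by its own cubic
    \<open>M\<close>; both composites follow by exchanging the roles.\<close>
  have "birational_inverse (extension F N) (extension G M)"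
    unfolding birational_inverse_def
    using ratmap ratmap_eq_extension_compose[OF assms(1) G(1) N M GF FG Ne]
      ratmap_eq_extension_compose[OF G(1) assms(1) M N FG GF MFe] by blast
  moreover have "ratmap_eq (extension F N) (extension F N)"
    using ratmap by (simp add: ratmap_eq_def mult.commute)
  ultimately have "cremona_bidegree 3 3 H"
    unfolding cremona_bidegree_def H
    using form_tuple_extension[OF assms(1) N] form_tuple_extension[OF G(1) M]
      no_common_factor_extension[OF assms(2) is_form_imp_polynomial[OF N] Ne]
      no_common_factor_extension[OF G(2) is_form_imp_polynomial[OF M] MFe] by blast
  moreover have "spampinato_type H"
  proof -
    note ranks = J.algebra_ranks[OF S(1) N p]
    let ?K = "algebra_adjoint (times_C_mult J.mul) (times_C_unit e) 4 J.\<sigma>"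
    \<comment> \<open>The adjoint sends \<open>(x, s)\<close> to \<open>(s *s Q x, N x)\<close> with
      \<open>Q x = \<psi> (F x)\<close>; applying \<open>\<phi>\<close> to the first component turns
      it into \<open>H\<close>.\<close>
    have "linearly_equivalent ?K H"
    proof (rule linearly_equivalent_by_iso)
      show "Vector_Spaces.linear (*s) (*s) (\<lambda>u. append_coord (\<phi> (drop_coord u)) (last_coord u))"
        by unfold_locales (simp_all add: vec_option_eq_iff \<phi>.add \<phi>.scale)
      show "Vector_Spaces.linear (*s) (*s) (\<lambda>u. append_coord (\<psi> (drop_coord u)) (last_coord u))"
        by unfold_locales (simp_all add: vec_option_eq_iff \<psi>.add \<psi>.scale)
      show "H u = append_coord (\<phi> (drop_coord (?K u))) (last_coord (?K u))" for u
        unfolding J.algebra_adjoint_times_C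
        by (simp add: H extension_def vec_option_eq_iff \<phi>.scale \<phi>_\<psi>)
    qed (simp_all add: H ratmap vec_option_eq_iff \<phi>_\<psi> \<psi>_\<phi>)
    then show ?thesis
      unfolding spampinato_type_def
      using J.power_associative_algebra_mul ranks J.generic_minimal_equation_times_C[OF S(1) N ranks(2)]
      by blast
  qed
  ultimately show ?thesis ..
qed

end
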